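(* Let $R$ be a $d\times d$ expansive integer matrix, let $B\subset\mathbb{Z}^d$ be a finite set with $0\in B$, $N:=|B|$, and suppose the self-affine measure $\mu=\mu(R,B)$ has no overlap. Assume there exist a finite set $L\subset\mathbb{Z}^d$ with $0\in L$ and complex numbers $(\alpha_l)_{l\in L}$ such that: (i) $\alpha_0=1$; (ii) the $|L|\times N$ matrix $T:=\frac{1}{\sqrt N}\left(e^{2\pi i (R^T)^{-1}l\cdot b}\,\alpha_l\right)_{l\in L,\,b\in B}$ satisfies $T^*T=I_N$ (its columns are orthonormal); (iii) the only entire function $h$ on $\mathbb{C}^d$ such that $0\le h\le 1$ on $\mathbb{R}^d$, $h(0)=1$, and $$\sum_{l\in L}|\alpha_l|^2\left|m_B\big((R^T)^{-1}(t-l)\big)\right|^2 h\big((R^T)^{-1}(t-l)\big)=h(t)\quad\text{for all } t\in\mathbb{R}^d,$$ is the constant function $1$. Then the set $$\left\{\Big(\prod_{i=0}^k\alpha_{l_i}\Big)e_{l_0+R^Tl_1+\dots+(R^T)^kl_k} : l_0\dots l_k\in\Omega(L)\right\}$$ is a Parseval frame for $L^2(\mu)$.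
   Context: A $d\times d$ real matrix is expansive if all its eigenvalues have modulus $>1$. For $b\in B$ let $\tau_b(x)=R^{-1}(x+b)$ on $\mathbb{R}^d$. The self-affine measure $\mu=\mu(R,B)$ is the unique Borel probability measure with $\mu(E)=\frac1N\sum_{b\in B}\mu(\tau_b^{-1}(E))$ for all Borel $E$; it is supported on the attractor $X_B=\{\sum_{k\ge1}R^{-k}b_k: b_k\in B\}$, the unique compact set with $X_B=\bigcup_{b\in B}\tau_b(X_B)$. $\mu$ has no overlap if $\mu(\tau_b(X_B)\cap\tau_{b'}(X_B))=0$ for all $b\neq b'$ in $B$. For $\lambda\in\mathbb{R}^d$, $e_\lambda(x)=e^{2\pi i\lambda\cdot x}$. $m_B(x)=\frac1N\sum_{b\in B}e^{2\pi i b\cdot x}$. $\Omega(L)$ is the set consisting of the empty word together with all finite words $l_0l_1\dots l_k$ ($k\ge0$) with $l_i\in L$ and $l_k\neq0$; the empty word corresponds to the element $e_0$ with weight $1$ (empty product). A family $\{f_i\}$ in a Hilbert space $H$ is a Parseval frame if $\sum_i|\langle v,f_i\rangle|^2=\|v\|^2$ for all $v\in H$. *)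

theory Defs
  imports "HOL-Analysis.Analysis"
begin

text \<open>Matrix power (the product on vec is componentwise, so we define it explicitly).\<close>
fun matpow :: "'a::comm_ring_1^'n^'n \<Rightarrow> nat \<Rightarrow> 'a^'n^'n" where
  "matpow A 0 = mat 1"
| "matpow A (Suc k) = A ** matpow A k"

definition cmat :: "real^'n^'n \<Rightarrow> complex^'n^'n" where
  "cmat A = (\<chi> i j. complex_of_real (A $ i $ j))"

definition cvec :: "real^'n \<Rightarrow> complex^'n" where
  "cvec x = (\<chi> i. complex_of_real (x $ i))"

definition expansive :: "real^'n^'n \<Rightarrow> bool" where
  "expansive A \<longleftrightarrow> (\<forall>c::complex. det (mat c - cmat A) = 0 \<longrightarrow> cmod c > 1)"

definition int_matrix :: "real^'n^'n \<Rightarrow> bool" where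
  "int_matrix A \<longleftrightarrow> (\<forall>i j. A $ i $ j \<in> \<int>)"

definition int_vec :: "real^'n \<Rightarrow> bool" where
  "int_vec x \<longleftrightarrow> (\<forall>i. x $ i \<in> \<int>)"

definition tau :: "real^'n^'n \<Rightarrow> real^'n \<Rightarrow> real^'n \<Rightarrow> real^'n" where
  "tau R b x = matrix_inv R *v (x + b)"

definition attractor :: "real^'n^'n \<Rightarrow> (real^'n) set \<Rightarrow> (real^'n) set" where
  "attractor R B = {x. \<exists>bs::nat \<Rightarrow> real^'n. (\<forall>k. bs k \<in> B) \<and>
      (\<lambda>k. matpow (matrix_inv R) (Suc k) *v bs k) sums x}"

text \<open>\<mu> is the self-affine measure \<mu>(R,B): the Borel probability measure satisfying
  the invariance identity (it is unique).\<close>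
definition self_affine_measure ::
    "real^'n^'n \<Rightarrow> (real^'n) set \<Rightarrow> (real^'n) measure \<Rightarrow> bool" where
  "self_affine_measure R B \<mu> \<longleftrightarrow> sets \<mu> = sets borel \<and> emeasure \<mu> (space \<mu>) = 1 \<and>
     (\<forall>E \<in> sets borel. measure \<mu> E =
        (1 / real (card B)) * (\<Sum>b\<in>B. measure \<mu> (tau R b -` E)))"

definition no_overlap :: "real^'n^'n \<Rightarrow> (real^'n) set \<Rightarrow> (real^'n) measure \<Rightarrow> bool" where
  "no_overlap R B \<mu> \<longleftrightarrow> (\<forall>b\<in>B. \<forall>b'\<in>B. b \<noteq> b' \<longrightarrow>
      measure \<mu> (tau R b ` attractor R B \<inter> tau R b' ` attractor R B) = 0)"

definition e_exp :: "real^'n \<Rightarrow> real^'n \<Rightarrow> complex" where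
  "e_exp w x = exp (2 * pi * \<i> * complex_of_real (w \<bullet> x))"

definition m_B :: "(real^'n) set \<Rightarrow> real^'n \<Rightarrow> complex" where
  "m_B B x = (1 / of_nat (card B)) * (\<Sum>b\<in>B. e_exp b x)"

definition entire_fun :: "(complex^'n \<Rightarrow> complex) \<Rightarrow> bool" where
  "entire_fun h \<longleftrightarrow> (\<forall>z. \<exists>D. (h has_derivative D) (at z) \<and>
      (\<forall>c v. D (c *s v) = c * D v))"

definition Omega :: "(real^'n) set \<Rightarrow> (real^'n) list set" where
  "Omega L = {ls. set ls \<subseteq> L \<and> (ls = [] \<or> last ls \<noteq> 0)}"

definition word_freq :: "real^'n^'n \<Rightarrow> (real^'n) list \<Rightarrow> real^'n" where
  "word_freq R ls = (\<Sum>i<length ls. matpow (transpose R) i *v ls ! i)"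

definition word_coeff :: "(real^'n \<Rightarrow> complex) \<Rightarrow> (real^'n) list \<Rightarrow> complex" where
  "word_coeff \<alpha> ls = (\<Prod>i<length ls. \<alpha> (ls ! i))"

definition parseval_frame_L2 ::
    "'a measure \<Rightarrow> 'i set \<Rightarrow> ('i \<Rightarrow> 'a \<Rightarrow> complex) \<Rightarrow> bool" where
  "parseval_frame_L2 \<mu> I F \<longleftrightarrow>
     (\<forall>f::'a \<Rightarrow> complex. f \<in> borel_measurable \<mu> \<and> integrable \<mu> (\<lambda>x. (cmod (f x))\<^sup>2) \<longrightarrow>
        ((\<lambda>i. (cmod (LINT x|\<mu>. f x * cnj (F i x)))\<^sup>2) has_sum
           (LINT x|\<mu>. (cmod (f x))\<^sup>2)) I)"

end

theory Submission
  imports Defs "HOL-Complex_Analysis.Complex_Analysis"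
begin

text \<open>
  For \<open>l \<in> L\<close> put \<open>(V\<^sub>l f)(x) = cnj \<alpha>\<^sub>l / N \<cdot> (\<Sum>b\<in>B. cnj (e\<^sub>l (\<tau>\<^sub>b x)) f (\<tau>\<^sub>b x))\<close>.
  Invariance of \<open>\<mu>\<close> and \<open>T\<^sup>*T = I\<close> give \<open>\<Sum>\<^sub>l \<parallel>V\<^sub>l f\<parallel>\<^sup>2 = \<parallel>f\<parallel>\<^sup>2\<close>, and the coefficient of \<open>f\<close> at
  the word \<open>l w\<close> is the coefficient of \<open>V\<^sub>l f\<close> at \<open>w\<close>. Induction on the length of words yields
  Bessel's inequality for the family, and the sum \<open>Q f\<close> of the squared coefficients satisfies
  \<open>Q f = \<Sum>\<^sub>l Q (V\<^sub>l f)\<close>. As \<open>V\<^sub>l\<close> maps exponentials to multiples of exponentials,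
  \<open>h t = Q e\<^sub>t\<close> solves the functional equation. It is the restriction of an entire function because
  \<open>Q\<close> comes from a bounded sesquilinear form and \<open>\<mu>\<close> has bounded support. Hence \<open>h = 1\<close>, so
  the positive quadratic form \<open>\<parallel>f\<parallel>\<^sup>2 - Q f\<close> vanishes on the exponentials; its zero set is a closed
  subspace, and the exponentials are total in \<open>L\<^sup>2(\<mu>)\<close> by Stone--Weierstrass.
\<close>

subsection \<open>Powers of the inverse of an expansive matrix\<close>

lemma matpow_Suc_mult_vector: "matpow A (Suc k) *v x = A *v (matpow A k *v x)"
  by (simp add: matrix_vector_mul_assoc)

lemma matpow_commute: "matpow A k ** A = A ** matpow A k"
  by (induction k) (simp_all add: matrix_mul_assoc[symmetric])

lemma matrix_inv_right:
  assumes "invertible A"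
  shows "A ** matrix_inv A = mat 1"
  using someI_ex[OF assms[unfolded invertible_def]] by (auto simp: matrix_inv_def)

lemma holomorphic_on_det:
  fixes M :: "complex \<Rightarrow> complex^'n^'n"
  assumes "\<And>i j. (\<lambda>z. M z $ i $ j) holomorphic_on U"
  shows "(\<lambda>z. det (M z)) holomorphic_on U"
  unfolding det_def by (intro holomorphic_intros assms)

text \<open>By Cramer's rule the resolvent is holomorphic on a disc of radius larger than 1, so its
  Taylor coefficients, which are the powers of the matrix, tend to 0.\<close>

lemma matpow_mult_vector_tendsto_0:
  fixes A :: "complex^'n^'n" and b :: "complex^'n"
  assumes nz: "\<And>z. norm z \<le> 1 \<Longrightarrow> det (\<chi> i j. (if i = j then 1 else 0) - z * A $ i $ j) \<noteq> 0"
  shows "(\<lambda>k. matpow A k *v b) \<longlonglongrightarrow> 0"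
proof -
  define M where "M z = (\<chi> i j. (if i = j then 1 else 0) - z * A $ i $ j)" for z
  \<comment> \<open>By Cramer's rule this is the solution of (I - z A) x = b, a quotient of
    functions holomorphic in z.\<close>
  define x where "x z = (\<chi> k. det (\<chi> i j. if j = k then b $ i else M z $ i $ j) / det (M z))" for z
  define U where "U = {z. det (M z) \<noteq> 0}"
  have hol_det: "(\<lambda>z. det (M z)) holomorphic_on UNIV"
    by (rule holomorphic_on_det) (auto simp: M_def intro!: holomorphic_intros)
  have "open U"
    unfolding U_def using holomorphic_on_imp_continuous_on[OF hol_det]
    by (intro open_Collect_neq) auto
  moreover have "cball 0 1 \<subseteq> U"
    using nz by (auto simp: U_def M_def)
  ultimately obtain e where e: "e > 0" "(\<Union>z\<in>cball 0 1. ball z e) \<subseteq> U"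
    using compact_subset_open_imp_ball_epsilon_subset[of "cball 0 1" U] by auto
  have U: "ball 0 (1 + e) \<subseteq> U"
  proof
    fix z :: complex assume z: "z \<in> ball 0 (1 + e)"
    show "z \<in> U"
    proof (cases "norm z \<le> 1")
      case True
      then show ?thesis using \<open>cball 0 1 \<subseteq> U\<close> by auto
    next
      case False
      \<comment> \<open>\<open>sgn z\<close> is the radial projection of z to the unit circle; its
        distance to z is norm z - 1 < e.\<close>
      have "norm z *\<^sub>R sgn z = z"
        by (cases "z = 0") (auto simp: sgn_div_norm)
      then have eq: "sgn z - z = (1 - norm z) *\<^sub>R sgn z"
        by (simp add: scaleR_diff_left)
      have "dist (sgn z) z = norm ((1 - norm z) *\<^sub>R sgn z)"
        by (simp add: dist_norm eq)
      also have "norm \<dots> = norm z - 1" using False by (auto simp: norm_sgn)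
      finally have "z \<in> ball (sgn z) e" using z by simp
      moreover have "sgn z \<in> cball 0 1" using False by (simp add: norm_sgn)
      ultimately show ?thesis using e by blast
    qed
  qed
  have hol: "(\<lambda>z. x z $ k) holomorphic_on ball 0 (1 + e)" for k
  proof -
    have "(\<lambda>z. det (\<chi> i j. if j = k then b $ i else M z $ i $ j)) holomorphic_on ball 0 (1 + e)"
    proof (rule holomorphic_on_det)
      fix i j
      show "(\<lambda>z. (\<chi> i j. if j = k then b $ i else M z $ i $ j) $ i $ j) holomorphic_on ball 0 (1 + e)"
        by (cases "j = k") (auto simp: M_def intro!: holomorphic_intros)
    qed
    then show ?thesis
      using U hol_det unfolding x_def U_def
      by (auto intro!: holomorphic_intros intro: holomorphic_on_subset)
  qed
  \<comment> \<open>In the form x = b + z A x the system becomes a recursion for the Taylor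
    coefficients.\<close>
  have x_eq: "x z $ i = b $ i + z * (\<Sum>j\<in>UNIV. A $ i $ j * x z $ j)" if "z \<in> ball 0 (1 + e)" for z i
  proof -
    have "det (M z) \<noteq> 0" using that U by (auto simp: U_def)
    then have "M z *v x z = b"
      unfolding cramer[OF \<open>det (M z) \<noteq> 0\<close>] by (simp add: x_def)
    then have "(\<Sum>j\<in>UNIV. ((if i = j then 1 else 0) - z * A $ i $ j) * x z $ j) = b $ i"
      by (auto simp: M_def matrix_vector_mult_def vec_eq_iff)
    then have "(\<Sum>j\<in>UNIV. (if i = j then x z $ j else 0) - z * (A $ i $ j * x z $ j)) = b $ i"
      by (simp add: left_diff_distrib mult.assoc if_distrib[of "\<lambda>u. u * _"] cong: if_cong)
    then show ?thesis
      by (simp add: sum_subtractf sum.delta sum_distrib_left algebra_simps)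
  qed
  define G where "G i = fps_expansion (\<lambda>z. x z $ i) 0" for i
  have G: "(\<lambda>z. x z $ i) has_fps_expansion G i" for i
    unfolding G_def by (rule has_fps_expansion_fps_expansion[OF _ _ hol]) (use e in auto)
  have G_eq: "G i = fps_const (b $ i) + fps_X * (\<Sum>j\<in>UNIV. fps_const (A $ i $ j) * G j)" for i
  proof -
    have "(\<lambda>z. b $ i + z * (\<Sum>j\<in>UNIV. A $ i $ j * x z $ j)) has_fps_expansion
        fps_const (b $ i) + fps_X * (\<Sum>j\<in>UNIV. fps_const (A $ i $ j) * G j)"
      by (intro fps_expansion_intros G)
    moreover have "eventually (\<lambda>z. z \<in> ball 0 (1 + e)) (nhds (0::complex))"
      using e by (intro eventually_nhds_in_open) auto
    then have "eventually (\<lambda>z. x z $ i = b $ i + z * (\<Sum>j\<in>UNIV. A $ i $ j * x z $ j)) (nhds 0)"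
      by eventually_elim (rule x_eq)
    ultimately have "(\<lambda>z. x z $ i) has_fps_expansion
        fps_const (b $ i) + fps_X * (\<Sum>j\<in>UNIV. fps_const (A $ i $ j) * G j)"
      by (rule iffD2[OF has_fps_expansion_cong[OF _ refl], rotated])
    with G show ?thesis by (rule fps_expansion_unique_complex)
  qed
  have G_0: "fps_nth (G i) 0 = b $ i" for i
    by (subst G_eq) simp
  have G_Suc: "fps_nth (G i) (Suc k) = (\<Sum>j\<in>UNIV. A $ i $ j * fps_nth (G j) k)" for i k
    by (subst G_eq) (simp add: fps_sum_nth)
  have coeff: "fps_nth (G i) k = (matpow A k *v b) $ i" for i k
  proof (induction k arbitrary: i)
    case 0
    then show ?case by (simp add: G_0)
  next
    case (Suc k)
    then show ?case
      unfolding matpow_Suc_mult_vector G_Suc by (simp add: matrix_vector_mult_def)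
  qed
  have "(\<lambda>k. (matpow A k *v b) $ i) \<longlonglongrightarrow> 0" for i
  proof -
    \<comment> \<open>The radius exceeds 1, so the Taylor series converges at z = 1 and its
      coefficients tend to 0.\<close>
    have "fps_conv_radius (G i) \<ge> ereal (1 + e)"
      unfolding G_def by (rule conv_radius_fps_expansion) (use hol[of i] in simp)
    moreover have "ereal (norm (1::complex)) < ereal (1 + e)"
      using e by simp
    ultimately have "ereal (norm (1::complex)) < fps_conv_radius (G i)"
      by (rule less_le_trans[rotated])
    from summable_LIMSEQ_zero[OF summable_fps[OF this]] show ?thesis
      by (simp add: coeff)
  qed
  then show ?thesis
    by (intro vec_tendstoI) simp
qed

section \<open>Complexification of real matrices and decay of the inverse powers\<close>

lemma cmat_mult_cvec: "cmat A *v cvec x = cvec (A *v x)"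
  by (simp add: cmat_def cvec_def matrix_vector_mult_def vec_eq_iff)

lemma matpow_cmat_mult_cvec: "matpow (cmat A) k *v cvec x = cvec (matpow A k *v x)"
proof (induction k)
  case (Suc k)
  then show ?case unfolding matpow_Suc_mult_vector by (simp add: cmat_mult_cvec)
qed simp

lemma cmat_mult: "cmat A ** cmat B = cmat (A ** B)"
  by (simp add: cmat_def matrix_matrix_mult_def vec_eq_iff)

lemma cmat_mat_1: "cmat (mat 1) = mat 1"
  by (simp add: cmat_def mat_def vec_eq_iff)

lemma det_cmat: "det (cmat A) = complex_of_real (det A)"
  by (simp add: det_def cmat_def)

lemma det_uminus_cart: "det (- A) = (-1) ^ CARD('n) * det (A :: 'a::comm_ring_1^'n^'n)"
proof -
  have "- A = (\<chi> i. (-1) *s A $ i)" by (simp add: vec_eq_iff)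
  then show ?thesis
    using det_rows_mul[of "\<lambda>_. -1" "\<lambda>i. A $ i"] by simp
qed

text \<open>Since 0 has modulus at most 1, it is not an eigenvalue.\<close>

lemma expansive_imp_invertible:
  fixes R :: "real^'n^'n"
  assumes "expansive R"
  shows "invertible R"
proof -
  have "det (mat 0 - cmat R) = (-1) ^ CARD('n) * det (cmat R)"
    using det_uminus_cart[of "cmat R"] by (simp add: mat_def vec_eq_iff zero_vec_def[symmetric])
  moreover have "det (mat 0 - cmat R) \<noteq> 0"
    using assms unfolding expansive_def by (metis norm_zero not_one_less_zero)
  ultimately show ?thesis
    by (auto simp: invertible_det_nz det_cmat)
qed

text \<open>From R (I - z R^-1) = R - z I and the absence of eigenvalues of modulus at most 1, det
  (I - z R^-1) is nonzero on the closed unit disc. So \<open>matpow_mult_vector_tendsto_0\<close>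
  applies to the complexified inverse.\<close>

lemma expansive_inverse_powers_tendsto_0:
  fixes R :: "real^'n^'n"
  assumes "expansive R"
  shows "(\<lambda>k. matpow (matrix_inv R) k *v x) \<longlonglongrightarrow> 0"
proof -
  let ?A = "matrix_inv R"
  have inv: "R ** ?A = mat 1"
    by (rule matrix_inv_right[OF expansive_imp_invertible[OF assms]])
  have "(\<lambda>k. matpow (cmat ?A) k *v cvec x) \<longlonglongrightarrow> 0"
  proof (rule matpow_mult_vector_tendsto_0)
    fix z :: complex assume z: "norm z \<le> 1"
    let ?M = "(\<chi> i j. (if i = j then 1 else 0) - z * cmat ?A $ i $ j) :: complex^'n^'n"
    have scale: "mat z ** X = (\<chi> i j. z * X $ i $ j)" for X :: "complex^'n^'n"
      by (simp add: vec_eq_iff mat_def matrix_matrix_mult_def if_distrib[of "\<lambda>u. u * _"] cong: if_cong)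
    have "?M = mat 1 - mat z ** cmat ?A"
      unfolding scale by (simp add: vec_eq_iff mat_def)
    then have "cmat R ** ?M = cmat R ** mat 1 - cmat R ** (mat z ** cmat ?A)"
      by (simp add: matrix_matrix_mult_def vec_eq_iff right_diff_distrib sum_subtractf)
    also have "cmat R ** (mat z ** cmat ?A) = mat z ** (cmat R ** cmat ?A)"
      unfolding scale
      by (simp add: matrix_matrix_mult_def vec_eq_iff sum_distrib_left mult.left_commute)
    also have "cmat R ** cmat ?A = mat 1"
      by (simp add: cmat_mult inv cmat_mat_1)
    finally have eq: "cmat R ** ?M = cmat R - mat z" by simp
    have "det (mat z - cmat R) \<noteq> 0"
      using assms z unfolding expansive_def by force
    moreover have "det (mat z - cmat R) = (-1) ^ CARD('n) * det (cmat R - mat z)"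
      using det_uminus_cart[of "cmat R - mat z"] by simp
    ultimately have "det (cmat R ** ?M) \<noteq> 0" by (auto simp: eq)
    then show "det ?M \<noteq> 0" by (auto simp: det_mul)
  qed
  then have "(\<lambda>k. cvec (matpow ?A k *v x) $ i) \<longlonglongrightarrow> 0" for i
    unfolding matpow_cmat_mult_cvec using tendsto_vec_nth by fastforce
  then have "(\<lambda>k. Re (cvec (matpow ?A k *v x) $ i)) \<longlonglongrightarrow> Re 0" for i
    by (intro tendsto_Re)
  then show ?thesis
    by (intro vec_tendstoI) (simp add: cvec_def)
qed

subsection \<open>Boundedness of the support\<close>

text \<open>Expanding x in the standard basis controls the matrix by finitely many vectors;
  convergence to 0 at each vector thereby becomes convergence in operator norm.\<close>

lemma norm_matrix_vector_le_sum_axis: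
  fixes A :: "real^'n^'n"
  shows "norm (A *v x) \<le> (\<Sum>i\<in>UNIV. norm (A *v axis i 1)) * norm x"
proof -
  have "A *v x = A *v (\<Sum>i\<in>UNIV. x $ i *\<^sub>R axis i 1)"
    using basis_expansion[of x] by (simp add: scalar_mult_eq_scaleR)
  also have "\<dots> = (\<Sum>i\<in>UNIV. x $ i *\<^sub>R (A *v axis i 1))"
    by (simp add: linear_sum[OF matrix_vector_mul_linear] linear_cmul[OF matrix_vector_mul_linear])
  also have "norm \<dots> \<le> (\<Sum>i\<in>UNIV. norm x * norm (A *v axis i 1))"
    by (rule sum_norm_le) (simp add: mult_right_mono component_le_norm_cart)
  finally show ?thesis by (simp add: sum_distrib_left mult.commute)
qed

text \<open>The adapted norm is the sum of the norms of the iterates up to a power that halves the norm.\<close>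

lemma ex_adapted_norm:
  fixes A :: "real^'n^'n"
  assumes lim: "\<And>x. (\<lambda>k. matpow A k *v x) \<longlonglongrightarrow> 0"
  obtains V :: "real^'n \<Rightarrow> real" and q :: real
  where "0 < q" "q < 1" "\<And>x. norm x \<le> V x" "\<And>x y. V (x + y) \<le> V x + V y"
    "\<And>x. V (A *v x) \<le> q * V x" "continuous_on UNIV V"
proof -
  have "(\<lambda>k. \<Sum>i\<in>UNIV. norm (matpow A k *v axis i 1)) \<longlonglongrightarrow> (\<Sum>i\<in>(UNIV::'n set). norm (0::real^'n))"
    by (intro tendsto_sum tendsto_norm lim)
  then have "eventually (\<lambda>k. (\<Sum>i\<in>UNIV. norm (matpow A k *v axis i 1)) < 1/2) sequentially"
    by (intro order_tendstoD) auto
  then have "eventually (\<lambda>k. k > 0 \<and> (\<Sum>i\<in>UNIV. norm (matpow A k *v axis i 1)) < 1/2) sequentially"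
    using eventually_gt_at_top[of 0] by eventually_elim auto
  then obtain p where p: "p > 0" "(\<Sum>i\<in>UNIV. norm (matpow A p *v axis i 1)) < 1/2"
    by (auto simp: eventually_sequentially)
  have half: "norm (matpow A p *v x) \<le> 1/2 * norm x" for x
    by (rule order_trans[OF norm_matrix_vector_le_sum_axis mult_right_mono]) (use p in auto)
  define V where "V x = (\<Sum>k<p. norm (matpow A k *v x))" for x
  \<comment> \<open>The summand 1 gives K >= 1, which keeps the rate q below strictly between 0 and
    1.\<close>
  define K where "K = 1 + (\<Sum>k<p. \<Sum>i\<in>UNIV. norm (matpow A k *v axis i 1))"
  have K: "V x \<le> K * norm x" for x
  proof -
    have "V x \<le> (\<Sum>k<p. (\<Sum>i\<in>UNIV. norm (matpow A k *v axis i 1)) * norm x)"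
      unfolding V_def by (intro sum_mono norm_matrix_vector_le_sum_axis)
    also have "\<dots> \<le> K * norm x"
      unfolding K_def by (simp add: sum_distrib_right[symmetric] mult_right_mono)
    finally show ?thesis .
  qed
  have K1: "K \<ge> 1" unfolding K_def by (simp add: sum_nonneg)
  \<comment> \<open>The proof below gives V (A x) <= V x - norm x / 2, and norm x >= V x / K turns
    the gain into a factor.\<close>
  define q where "q = 1 - 1 / (2 * K)"
  show thesis
  proof
    show "0 < q" "q < 1" using K1 by (auto simp: q_def field_simps)
    show "norm x \<le> V x" for x
      unfolding V_def using member_le_sum[of 0 "{..<p}" "\<lambda>k. norm (matpow A k *v x)"] p by simp
    show "V (x + y) \<le> V x + V y" for x y
      unfolding V_def sum.distrib[symmetric]
      by (intro sum_mono) (simp add: matrix_vector_right_distrib norm_triangle_ineq)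
    show "continuous_on UNIV V"
      unfolding V_def
      by (intro continuous_intros linear_continuous_on[OF matrix_vector_mul_bounded_linear])
    fix x
    \<comment> \<open>Applying A shifts the sum: the term k = 0 is lost and the term k = p is
      gained.\<close>
    have "V (A *v x) = (\<Sum>k<p. norm (matpow A (Suc k) *v x))"
      unfolding V_def by (simp add: matrix_vector_mul_assoc matpow_commute del: matpow.simps)
         (simp add: matpow_commute)
    also have "\<dots> = V x - norm x + norm (matpow A p *v x)"
      unfolding V_def sum.lessThan_Suc_shift[of _ p, symmetric]
      using sum.lessThan_Suc_shift[of "\<lambda>k. norm (matpow A k *v x)" p] by simp
    also have "\<dots> \<le> V x - 1/2 * norm x" using half[of x] by simp
    also have "\<dots> \<le> V x - V x / (2 * K)"
      using K[of x] K1 by (simp add: field_simps)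
    also have "\<dots> = q * V x" by (simp add: q_def algebra_simps)
    finally show "V (A *v x) \<le> q * V x" .
  qed
qed

text \<open>Each \<open>tau R b\<close> maps the sublevel set D (r + s/q) into D (r + s), so by
  invariance the first set has no more mass than the second. Iterating from s = 1, the sets D (r +
  1/q^k) exhaust the space, hence D (r + 1) already has full measure.\<close>

lemma self_affine_measure_bounded_support:
  fixes R :: "real^'n^'n"
  assumes "expansive R" "finite B" "B \<noteq> {}" and \<mu>: "self_affine_measure R B \<mu>"
  obtains M where "M \<ge> 0" "AE x in \<mu>. norm x \<le> M"
proof -
  have sets: "sets \<mu> = sets borel" and space: "emeasure \<mu> (space \<mu>) = 1"
    using \<mu> by (auto simp: self_affine_measure_def)
  have space': "space \<mu> = UNIV" using sets_eq_imp_space_eq[OF sets] by simp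
  interpret finite_measure \<mu> by standard (simp add: space)
  obtain V q where q: "0 < q" "q < 1" and V: "\<And>x. norm x \<le> V x" "\<And>x y. V (x + y) \<le> V x + V y"
    "\<And>x. V (matrix_inv R *v x) \<le> q * V x" and cont: "continuous_on UNIV V"
    using ex_adapted_norm[OF expansive_inverse_powers_tendsto_0[OF assms(1)]] by metis
  define c where "c = Max (V ` B)"
  have c: "V b \<le> c" if "b \<in> B" for b
    unfolding c_def using assms that by (intro Max_ge) auto
  have c0: "c \<ge> 0" using c assms(3) V(1) norm_ge_zero by (meson all_not_in_conv order_trans)
  define D where "D \<rho> = {x. V x \<le> \<rho>}" for \<rho>
  have D: "D \<rho> \<in> sets borel" for \<rho>
    unfolding D_def by (intro borel_closed closed_Collect_le cont) auto
  \<comment> \<open>The solution of q (r + c) = r, so that every \<open>tau R b\<close> maps D r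
    into itself.\<close>
  define r where "r = c * q / (1 - q)"
  have r: "r / q - c = r" using q by (simp add: r_def field_simps)
  have r0: "r \<ge> 0" using c0 q by (simp add: r_def)
  have step: "measure \<mu> (D (r + s / q)) \<le> measure \<mu> (D (r + s))" for s
  proof -
    have sub: "D (r + s / q) \<subseteq> tau R b -` D (r + s)" if "b \<in> B" for b
    proof
      fix x assume "x \<in> D (r + s / q)"
      then have x: "V x \<le> r + s / q" by (simp add: D_def)
      have "V (tau R b x) \<le> q * (V x + V b)"
        unfolding tau_def using V(3)[of "x + b"] V(2)[of x b] q
        by (meson less_eq_real_def mult_left_mono order_trans)
      also have "\<dots> \<le> q * (r + s / q + c)" using x c[OF that] q by (intro mult_left_mono) auto
      also have "\<dots> = q * (r / q + s / q)" using r by (simp add: algebra_simps)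
      also have "\<dots> = r + s" using q by (simp add: field_simps)
      finally show "x \<in> tau R b -` D (r + s)" by (simp add: D_def)
    qed
    have meas: "tau R b -` D \<rho> \<in> sets borel" for b \<rho>
    proof -
      have "continuous_on UNIV (tau R b)" unfolding tau_def
        by (intro linear_continuous_on_compose[OF _ matrix_vector_mul_linear] continuous_intros)
      from measurable_sets[OF borel_measurable_continuous_onI[OF this] D] show ?thesis by simp
    qed
    have "real (card B) * measure \<mu> (D (r + s / q)) = (\<Sum>b\<in>B. measure \<mu> (D (r + s / q)))" by simp
    also have "\<dots> \<le> (\<Sum>b\<in>B. measure \<mu> (tau R b -` D (r + s)))"
      by (intro sum_mono finite_measure_mono sub) (auto simp: sets meas)
    also have "\<dots> = real (card B) * measure \<mu> (D (r + s))"
      using \<mu> D[of "r + s"] assms(2,3) unfolding self_affine_measure_def by simp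
    finally show ?thesis using assms(2,3) by (simp add: card_gt_0_iff)
  qed
  have iter: "measure \<mu> (D (r + 1 / q ^ k)) \<le> measure \<mu> (D (r + 1))" for k
  proof (induction k)
    case (Suc k)
    have "measure \<mu> (D (r + 1 / q ^ Suc k)) \<le> measure \<mu> (D (r + 1 / q ^ k))"
      using step[of "1 / q ^ k"] by (simp add: mult.commute)
    with Suc show ?case by simp
  qed simp
  have "(\<lambda>k. measure \<mu> (D (r + 1 / q ^ k))) \<longlonglongrightarrow> measure \<mu> (\<Union>k. D (r + 1 / q ^ k))"
  proof (rule finite_Lim_measure_incseq)
    show "range (\<lambda>k. D (r + 1 / q ^ k)) \<subseteq> sets \<mu>" using D sets by auto
    show "incseq (\<lambda>k. D (r + 1 / q ^ k))"
    proof (rule incseq_SucI)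
      fix k
      have "q ^ Suc k \<le> q ^ k" using q by (intro power_decreasing) auto
      then have "1 / q ^ k \<le> 1 / q ^ Suc k" using q by (intro divide_left_mono) auto
      then show "D (r + 1 / q ^ k) \<subseteq> D (r + 1 / q ^ Suc k)" by (auto simp: D_def)
    qed
  qed
  moreover have "(\<Union>k. D (r + 1 / q ^ k)) = space \<mu>"
  proof -
    have "\<exists>k. V x \<le> r + 1 / q ^ k" for x
    proof -
      have "1 < 1 / q" using q by simp
      then obtain k where "V x < (1 / q) ^ k" using real_arch_pow by blast
      then show ?thesis using r0 by (intro exI[of _ k]) (simp add: power_one_over)
    qed
    then show ?thesis by (auto simp: D_def space')
  qed
  moreover have "measure \<mu> (space \<mu>) = 1" using space by (simp add: measure_def)
  ultimately have "1 \<le> measure \<mu> (D (r + 1))"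
    using LIMSEQ_le_const2 iter by fastforce
  then have "measure \<mu> (D (r + 1)) = measure \<mu> (space \<mu>)"
    using \<open>measure \<mu> (space \<mu>) = 1\<close> bounded_measure[of "D (r + 1)"] by simp
  then have "AE x in \<mu>. x \<in> D (r + 1)"
    using D sets AE_iff_measurable[of "space \<mu> - D (r + 1)" \<mu> "\<lambda>x. x \<in> D (r + 1)"]
      finite_measure_compl[of "D (r + 1)"] emeasure_eq_measure
    by (auto simp: space')
  then have "AE x in \<mu>. norm x \<le> r + 1"
    by eventually_elim (use V(1) order_trans in \<open>auto simp: D_def\<close>)
  moreover have "r + 1 \<ge> 0" using r0 by simp
  ultimately show thesis using that by blast
qed

subsection \<open>Square-integrable functions\<close>

definition sq_integrable :: "'a measure \<Rightarrow> ('a \<Rightarrow> complex) \<Rightarrow> bool" where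
  "sq_integrable M f \<longleftrightarrow> f \<in> borel_measurable M \<and> integrable M (\<lambda>x. (cmod (f x))\<^sup>2)"

definition L2_inner :: "'a measure \<Rightarrow> ('a \<Rightarrow> complex) \<Rightarrow> ('a \<Rightarrow> complex) \<Rightarrow> complex" where
  "L2_inner M f g = (LINT x|M. f x * cnj (g x))"

definition L2_sqnorm :: "'a measure \<Rightarrow> ('a \<Rightarrow> complex) \<Rightarrow> real" where
  "L2_sqnorm M f = (LINT x|M. (cmod (f x))\<^sup>2)"

lemma cmod_add_square_le: "(cmod (a + b))\<^sup>2 \<le> 2 * (cmod a)\<^sup>2 + 2 * (cmod b)\<^sup>2"
proof -
  have "(cmod (a + b))\<^sup>2 \<le> (cmod a + cmod b)\<^sup>2"
    by (intro power_mono norm_triangle_ineq) auto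
  also have "\<dots> \<le> 2 * (cmod a)\<^sup>2 + 2 * (cmod b)\<^sup>2"
    using zero_le_power2[of "cmod a - cmod b"] by (simp add: power2_eq_square algebra_simps)
  finally show ?thesis .
qed

lemma cmod_parallelogram:
  "(cmod (a + b))\<^sup>2 + (cmod (a - b))\<^sup>2 = 2 * (cmod a)\<^sup>2 + 2 * (cmod b)\<^sup>2"
  unfolding cmod_power2 by (simp add: power2_eq_square algebra_simps)

lemma borel_measurable_cnj [measurable]: "cnj \<in> borel_measurable borel"
  by (intro borel_measurable_continuous_onI continuous_intros)

lemma sq_integrableD:
  assumes "sq_integrable M f"
  shows "f \<in> borel_measurable M" "integrable M (\<lambda>x. (cmod (f x))\<^sup>2)"
  using assms by (auto simp: sq_integrable_def)

lemma sq_integrable_add: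
  assumes "sq_integrable M f" "sq_integrable M g"
  shows "sq_integrable M (\<lambda>x. f x + g x)"
proof -
  note [measurable] = sq_integrableD(1)[OF assms(1)] sq_integrableD(1)[OF assms(2)]
  have "integrable M (\<lambda>x. 2 * (cmod (f x))\<^sup>2 + 2 * (cmod (g x))\<^sup>2)"
    using assms by (auto simp: sq_integrable_def)
  then have "integrable M (\<lambda>x. (cmod (f x + g x))\<^sup>2)"
    by (rule Bochner_Integration.integrable_bound) (simp_all add: cmod_add_square_le)
  then show ?thesis by (simp add: sq_integrable_def)
qed

lemma sq_integrable_cmult:
  assumes "sq_integrable M f"
  shows "sq_integrable M (\<lambda>x. c * f x)"
  using assms by (auto simp: sq_integrable_def norm_mult power_mult_distrib)

lemma sq_integrable_uminus:
  assumes "sq_integrable M f"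
  shows "sq_integrable M (\<lambda>x. - f x)"
  using sq_integrable_cmult[OF assms, of "-1"] by simp

lemma sq_integrable_diff:
  assumes "sq_integrable M f" "sq_integrable M g"
  shows "sq_integrable M (\<lambda>x. f x - g x)"
  using sq_integrable_add[OF assms(1) sq_integrable_uminus[OF assms(2)]] by simp

lemma sq_integrable_zero: "sq_integrable M (\<lambda>x. 0)"
  by (simp add: sq_integrable_def)

lemma sq_integrable_sum:
  assumes "\<And>i. i \<in> I \<Longrightarrow> sq_integrable M (f i)"
  shows "sq_integrable M (\<lambda>x. \<Sum>i\<in>I. f i x)"
  using assms
  by (induction I rule: infinite_finite_induct) (simp_all add: sq_integrable_zero sq_integrable_add)

lemma sq_integrable_dominated:
  assumes g: "sq_integrable M g" and [measurable]: "f \<in> borel_measurable M"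
    and le: "AE x in M. cmod (f x) \<le> c * cmod (g x)"
  shows "sq_integrable M f"
proof -
  have int: "integrable M (\<lambda>x. c\<^sup>2 * (cmod (g x))\<^sup>2)"
    using sq_integrableD(2)[OF g] by simp
  have "AE x in M. norm ((cmod (f x))\<^sup>2) \<le> norm (c\<^sup>2 * (cmod (g x))\<^sup>2)"
    using le
  proof eventually_elim
    case (elim x)
    then have "(cmod (f x))\<^sup>2 \<le> (c * cmod (g x))\<^sup>2" by (intro power_mono) auto
    then show ?case by (simp add: power_mult_distrib)
  qed
  then have "integrable M (\<lambda>x. (cmod (f x))\<^sup>2)"
    by (rule Bochner_Integration.integrable_bound[OF int, rotated]) simp
  then show ?thesis by (simp add: sq_integrable_def)
qed

lemma (in finite_measure) sq_integrable_const: "sq_integrable M (\<lambda>x. c)"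
  by (simp add: sq_integrable_def)

lemma (in finite_measure) sq_integrable_AE_bounded:
  assumes "f \<in> borel_measurable M" "AE x in M. cmod (f x) \<le> c"
  shows "sq_integrable M f"
  by (rule sq_integrable_dominated[OF sq_integrable_const[of 1], of _ c]) (use assms in auto)

lemma integrable_mult_cnj:
  assumes "sq_integrable M f" "sq_integrable M g"
  shows "integrable M (\<lambda>x. f x * cnj (g x))"
proof -
  note [measurable] = sq_integrableD(1)[OF assms(1)] sq_integrableD(1)[OF assms(2)]
  have int: "integrable M (\<lambda>x. (cmod (f x))\<^sup>2 + (cmod (g x))\<^sup>2)"
    using assms by (auto simp: sq_integrable_def)
  have le: "cmod a * cmod b \<le> (cmod a)\<^sup>2 + (cmod b)\<^sup>2" for a b
  proof -
    have "2 * (cmod a * cmod b) \<le> (cmod a)\<^sup>2 + (cmod b)\<^sup>2"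
      using zero_le_power2[of "cmod a - cmod b"] by (simp add: power2_eq_square algebra_simps)
    moreover have "0 \<le> cmod a * cmod b" by simp
    ultimately show ?thesis by linarith
  qed
  show ?thesis
    by (rule Bochner_Integration.integrable_bound[OF int]) (measurable, simp add: norm_mult le)
qed

lemma L2_inner_add_left:
  assumes "sq_integrable M f" "sq_integrable M g" "sq_integrable M h"
  shows "L2_inner M (\<lambda>x. f x + g x) h = L2_inner M f h + L2_inner M g h"
  unfolding L2_inner_def distrib_right
  by (intro Bochner_Integration.integral_add integrable_mult_cnj assms)

lemma L2_inner_diff_left:
  assumes "sq_integrable M f" "sq_integrable M g" "sq_integrable M h"
  shows "L2_inner M (\<lambda>x. f x - g x) h = L2_inner M f h - L2_inner M g h"
  unfolding L2_inner_def left_diff_distrib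
  by (intro Bochner_Integration.integral_diff integrable_mult_cnj assms)

lemma L2_inner_cmult_left: "L2_inner M (\<lambda>x. c * f x) g = c * L2_inner M f g"
  by (simp add: L2_inner_def mult.assoc)

lemma L2_sqnorm_nonneg: "L2_sqnorm M f \<ge> 0"
  by (simp add: L2_sqnorm_def)

lemma L2_sqnorm_cmult: "L2_sqnorm M (\<lambda>x. c * f x) = (cmod c)\<^sup>2 * L2_sqnorm M f"
  by (simp add: L2_sqnorm_def norm_mult power_mult_distrib)

lemma L2_sqnorm_parallelogram:
  assumes "sq_integrable M f" "sq_integrable M g"
  shows "L2_sqnorm M (\<lambda>x. f x + g x) + L2_sqnorm M (\<lambda>x. f x - g x)
    = 2 * L2_sqnorm M f + 2 * L2_sqnorm M g"
proof -
  have "L2_sqnorm M (\<lambda>x. f x + g x) + L2_sqnorm M (\<lambda>x. f x - g x)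
    = (LINT x|M. (cmod (f x + g x))\<^sup>2 + (cmod (f x - g x))\<^sup>2)"
    unfolding L2_sqnorm_def
    by (intro Bochner_Integration.integral_add[symmetric] sq_integrableD(2) sq_integrable_add sq_integrable_diff assms)
  also have "\<dots> = (LINT x|M. 2 * (cmod (f x))\<^sup>2 + 2 * (cmod (g x))\<^sup>2)"
    by (simp only: cmod_parallelogram)
  also have "\<dots> = 2 * L2_sqnorm M f + 2 * L2_sqnorm M g"
    unfolding L2_sqnorm_def using assms[THEN sq_integrableD(2)] by simp
  finally show ?thesis .
qed

lemma (in finite_measure) L2_sqnorm_le_bound:
  assumes "AE x in M. cmod (f x) \<le> c" "f \<in> borel_measurable M"
    and M: "measure M (space M) = 1"
  shows "L2_sqnorm M f \<le> c\<^sup>2"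
proof -
  have "L2_sqnorm M f \<le> (LINT x|M. c\<^sup>2)"
    unfolding L2_sqnorm_def
  proof (rule integral_mono_AE)
    show "AE x in M. (cmod (f x))\<^sup>2 \<le> c\<^sup>2"
      using assms(1) by eventually_elim (auto intro: power_mono)
  qed (use sq_integrable_AE_bounded assms in \<open>auto simp: sq_integrable_def\<close>)
  then show ?thesis using M by simp
qed

text \<open>Nonnegativity of the variance. It bounds the coefficient at the empty word, the base
  case of Bessel's inequality.\<close>

lemma (in finite_measure) integral_square_le_L2_sqnorm:
  assumes f: "sq_integrable M f" and M: "measure M (space M) = 1"
  shows "(cmod (LINT x|M. f x))\<^sup>2 \<le> L2_sqnorm M f"
proof -
  note [measurable] = sq_integrableD(1)[OF f]
  define c where "c = (LINT x|M. f x)"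
  have int: "integrable M f"
    using integrable_mult_cnj[OF f sq_integrable_const[of 1]] by simp
  have "0 \<le> (LINT x|M. (cmod (f x - c))\<^sup>2)" by simp
  also have "(\<lambda>x. (cmod (f x - c))\<^sup>2) = (\<lambda>x. (cmod (f x))\<^sup>2 - 2 * Re (cnj c * f x) + (cmod c)\<^sup>2)"
    unfolding cmod_power2 by (simp add: fun_eq_iff power2_eq_square algebra_simps)
  also have "(LINT x|M. \<dots> x) = L2_sqnorm M f - 2 * Re (cnj c * c) + (cmod c)\<^sup>2"
    using int sq_integrableD(2)[OF f] M by (simp add: L2_sqnorm_def c_def)
  also have "\<dots> = L2_sqnorm M f - (cmod c)\<^sup>2"
    unfolding cmod_power2 by (simp add: power2_eq_square)
  finally show ?thesis by (simp add: c_def)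
qed

subsection \<open>Bessel families\<close>

text \<open>Bessel's inequality is assumed on finite subfamilies; bounded partial sums of
  nonnegative terms then give summability over I.\<close>

locale bessel_family = finite_measure M for M :: "'a measure" +
  fixes I :: "'i set" and F :: "'i \<Rightarrow> 'a \<Rightarrow> complex"
  assumes sq_integrable_F: "i \<in> I \<Longrightarrow> sq_integrable M (F i)"
    and bessel: "sq_integrable M f \<Longrightarrow> finite J \<Longrightarrow> J \<subseteq> I \<Longrightarrow>
      (\<Sum>i\<in>J. (cmod (L2_inner M f (F i)))\<^sup>2) \<le> L2_sqnorm M f"
begin

definition energy :: "('a \<Rightarrow> complex) \<Rightarrow> real" where
  "energy f = (\<Sum>\<^sub>\<infinity>i\<in>I. (cmod (L2_inner M f (F i)))\<^sup>2)"

text \<open>The inner product of S f with g, where S is the frame operator of the family; antilinear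
  in g.\<close>

definition frame_form :: "('a \<Rightarrow> complex) \<Rightarrow> ('a \<Rightarrow> complex) \<Rightarrow> complex" where
  "frame_form f g = (\<Sum>\<^sub>\<infinity>i\<in>I. L2_inner M f (F i) * cnj (L2_inner M g (F i)))"

text \<open>The quadratic form of id - S for the frame operator S; it is nonnegative by Bessel's
  inequality.\<close>

definition defect :: "('a \<Rightarrow> complex) \<Rightarrow> real" where
  "defect f = L2_sqnorm M f - energy f"

lemma summable_energy:
  assumes "sq_integrable M f"
  shows "(\<lambda>i. (cmod (L2_inner M f (F i)))\<^sup>2) summable_on I"
  by (rule nonneg_bdd_above_summable_on)
     (auto intro!: bdd_aboveI2[where M = "L2_sqnorm M f"] bessel assms)

lemma energy_nonneg: "energy f \<ge> 0"
  unfolding energy_def by (intro infsum_nonneg) auto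

lemma energy_le_L2_sqnorm:
  assumes "sq_integrable M f"
  shows "energy f \<le> L2_sqnorm M f"
  unfolding energy_def
  by (rule infsum_le_finite_sums[OF summable_energy[OF assms]]) (use bessel assms in auto)

lemma energy_cmult: "energy (\<lambda>x. c * f x) = (cmod c)\<^sup>2 * energy f"
  by (simp add: energy_def L2_inner_cmult_left norm_mult power_mult_distrib infsum_cmult_right')

lemma energy_parallelogram:
  assumes f: "sq_integrable M f" and g: "sq_integrable M g"
  shows "energy (\<lambda>x. f x + g x) + energy (\<lambda>x. f x - g x) = 2 * energy f + 2 * energy g"
proof -
  have "energy (\<lambda>x. f x + g x) + energy (\<lambda>x. f x - g x)
    = (\<Sum>\<^sub>\<infinity>i\<in>I. (cmod (L2_inner M (\<lambda>x. f x + g x) (F i)))\<^sup>2 + (cmod (L2_inner M (\<lambda>x. f x - g x) (F i)))\<^sup>2)"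
    unfolding energy_def
    by (intro infsum_add[symmetric] summable_energy sq_integrable_add sq_integrable_diff f g)
  also have "\<dots> = (\<Sum>\<^sub>\<infinity>i\<in>I. 2 * (cmod (L2_inner M f (F i)))\<^sup>2 + 2 * (cmod (L2_inner M g (F i)))\<^sup>2)"
    by (intro infsum_cong)
       (simp add: L2_inner_add_left L2_inner_diff_left f g sq_integrable_F cmod_parallelogram)
  also have "\<dots> = 2 * energy f + 2 * energy g"
    unfolding energy_def
    by (subst infsum_add) (auto intro!: summable_on_cmult_right summable_energy f g simp: infsum_cmult_right')
  finally show ?thesis .
qed

section \<open>The defect form and its zero set\<close>

lemma defect_nonneg: "sq_integrable M f \<Longrightarrow> defect f \<ge> 0"
  using energy_le_L2_sqnorm by (simp add: defect_def)

lemma defect_le_L2_sqnorm: "defect f \<le> L2_sqnorm M f"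
  using energy_nonneg by (simp add: defect_def)

lemma defect_cmult: "defect (\<lambda>x. c * f x) = (cmod c)\<^sup>2 * defect f"
  by (simp add: defect_def energy_cmult L2_sqnorm_cmult algebra_simps)

text \<open>Norm and energy both satisfy the parallelogram law, hence so does the defect; dropping
  the nonnegative defect of f - g leaves this bound. It stands in for Cauchy-Schwarz in showing that
  the zero set is a subspace.\<close>

lemma defect_add_le:
  assumes "sq_integrable M f" "sq_integrable M g"
  shows "defect (\<lambda>x. f x + g x) \<le> 2 * defect f + 2 * defect g"
  using L2_sqnorm_parallelogram[OF assms] energy_parallelogram[OF assms]
    defect_nonneg[OF sq_integrable_diff[OF assms]]
  by (simp add: defect_def)

definition tight :: "('a \<Rightarrow> complex) \<Rightarrow> bool" where
  "tight f \<longleftrightarrow> sq_integrable M f \<and> defect f = 0"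

lemma tight_add: "tight f \<Longrightarrow> tight g \<Longrightarrow> tight (\<lambda>x. f x + g x)"
  using defect_add_le[of f g] defect_nonneg[OF sq_integrable_add[of M f g]]
  by (simp add: tight_def sq_integrable_add)

lemma tight_cmult: "tight f \<Longrightarrow> tight (\<lambda>x. c * f x)"
  by (simp add: tight_def defect_cmult sq_integrable_cmult)

lemma tight_zero: "tight (\<lambda>x. 0)"
  using defect_nonneg[OF sq_integrable_zero] defect_le_L2_sqnorm[of "\<lambda>x. 0"]
  by (auto simp: tight_def sq_integrable_zero L2_sqnorm_def)

lemma tight_sum: "(\<And>i. i \<in> A \<Longrightarrow> tight (f i)) \<Longrightarrow> tight (\<lambda>x. \<Sum>i\<in>A. f i x)"
  by (induction A rule: infinite_finite_induct) (simp_all add: tight_zero tight_add)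

text \<open>The defect is at most the squared norm, so defect f <= 2 defect g + 2 ||f - g||^2, where
  defect g = 0. The factor 2 explains the choice of e / 2.\<close>

lemma tight_approx:
  assumes f: "sq_integrable M f"
    and approx: "\<And>e. e > 0 \<Longrightarrow> \<exists>g. tight g \<and> L2_sqnorm M (\<lambda>x. f x - g x) \<le> e"
  shows "tight f"
proof -
  have "defect f \<le> 0"
  proof (rule field_le_epsilon)
    fix e :: real assume "e > 0"
    then obtain g where g: "tight g" "L2_sqnorm M (\<lambda>x. f x - g x) \<le> e / 2"
      using approx[of "e / 2"] by auto
    then have gi: "sq_integrable M g" by (simp add: tight_def)
    have "defect f = defect (\<lambda>x. g x + (f x - g x))" by simp
    also have "\<dots> \<le> 2 * defect g + 2 * defect (\<lambda>x. f x - g x)"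
      by (rule defect_add_le[OF gi sq_integrable_diff[OF f gi]])
    also have "\<dots> \<le> e"
      using g defect_le_L2_sqnorm[of "\<lambda>x. f x - g x"] by (simp add: tight_def)
    finally show "defect f \<le> 0 + e" by simp
  qed
  with defect_nonneg[OF f] f show ?thesis by (simp add: tight_def)
qed

text \<open>With one function dominating both the sequence and its limit, |f - s n|^2 is at most 4
  c^2 |g|^2, so pointwise convergence becomes convergence in L2.\<close>

lemma tight_dominated_limit:
  assumes s: "\<And>n. tight (s n)" and g: "sq_integrable M g"
    and [measurable]: "f \<in> borel_measurable M"
    and lim: "AE x in M. (\<lambda>n. s n x) \<longlonglongrightarrow> f x"
    and le: "\<And>n. AE x in M. cmod (s n x) \<le> c * cmod (g x)"
    and le': "AE x in M. cmod (f x) \<le> c * cmod (g x)"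
  shows "tight f"
proof (rule tight_approx)
  have s': "sq_integrable M (s n)" for n using s by (simp add: tight_def)
  note [measurable] = sq_integrableD(1)[OF s'] sq_integrableD(1)[OF g]
  show f: "sq_integrable M f"
    by (rule sq_integrable_dominated[OF g _ le']) measurable
  have "(\<lambda>n. LINT x|M. (cmod (f x - s n x))\<^sup>2) \<longlonglongrightarrow> (LINT x|M. 0)"
  proof (rule integral_dominated_convergence)
    show "integrable M (\<lambda>x. 4 * c\<^sup>2 * (cmod (g x))\<^sup>2)"
      using sq_integrableD(2)[OF g] by simp
    show "AE x in M. (\<lambda>n. (cmod (f x - s n x))\<^sup>2) \<longlonglongrightarrow> 0"
      using lim
    proof eventually_elim
      case (elim x)
      then have "(\<lambda>n. (cmod (f x - s n x))\<^sup>2) \<longlonglongrightarrow> (cmod (f x - f x))\<^sup>2"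
        by (intro tendsto_intros)
      then show ?case by simp
    qed
    show "AE x in M. norm ((cmod (f x - s n x))\<^sup>2) \<le> 4 * c\<^sup>2 * (cmod (g x))\<^sup>2" for n
      using le[of n] le'
    proof eventually_elim
      case (elim x)
      have "cmod (f x - s n x) \<le> 2 * (c * cmod (g x))"
        using elim norm_triangle_ineq4[of "f x" "s n x"] by linarith
      then have "(cmod (f x - s n x))\<^sup>2 \<le> (2 * (c * cmod (g x)))\<^sup>2"
        by (intro power_mono) auto
      then show ?case by (simp add: power_mult_distrib)
    qed
  qed auto
  then have lim0: "(\<lambda>n. L2_sqnorm M (\<lambda>x. f x - s n x)) \<longlonglongrightarrow> 0"
    by (simp add: L2_sqnorm_def)
  show "\<exists>g. tight g \<and> L2_sqnorm M (\<lambda>x. f x - g x) \<le> e" if "e > 0" for e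
    using order_tendstoD(2)[OF lim0 that] s
    by (auto simp: eventually_sequentially intro: less_imp_le)
qed

text \<open>Cauchy-Schwarz on a finite subfamily, then Bessel in both factors, gives a bound
  independent of the subfamily. Absolute summability and continuity of the form both follow.\<close>

lemma frame_form_bounds:
  assumes f: "sq_integrable M f" and g: "sq_integrable M g"
  shows "(\<lambda>i. norm (L2_inner M f (F i) * cnj (L2_inner M g (F i)))) summable_on I"
    and "cmod (frame_form f g) \<le> sqrt (L2_sqnorm M f) * sqrt (L2_sqnorm M g)"
proof -
  let ?a = "\<lambda>i. L2_inner M f (F i)" and ?b = "\<lambda>i. L2_inner M g (F i)"
  have le: "(\<Sum>i\<in>J. cmod (?a i * cnj (?b i))) \<le> sqrt (L2_sqnorm M f) * sqrt (L2_sqnorm M g)"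
    if J: "finite J" "J \<subseteq> I" for J
  proof -
    have "(\<Sum>i\<in>J. cmod (?a i * cnj (?b i))) = (\<Sum>i\<in>J. \<bar>cmod (?a i)\<bar> * \<bar>cmod (?b i)\<bar>)"
      by (simp add: norm_mult)
    also have "\<dots> \<le> L2_set (\<lambda>i. cmod (?a i)) J * L2_set (\<lambda>i. cmod (?b i)) J"
      by (rule L2_set_mult_ineq)
    also have "\<dots> \<le> sqrt (L2_sqnorm M f) * sqrt (L2_sqnorm M g)"
      unfolding L2_set_def using J f g
      by (intro mult_mono real_sqrt_le_mono bessel) (auto simp: L2_sqnorm_nonneg sum_nonneg)
    finally show ?thesis .
  qed
  show sm: "(\<lambda>i. norm (?a i * cnj (?b i))) summable_on I"
    by (rule nonneg_bdd_above_summable_on)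
       (auto intro!: bdd_aboveI2[where M = "sqrt (L2_sqnorm M f) * sqrt (L2_sqnorm M g)"] le)
  have "cmod (frame_form f g) \<le> (\<Sum>\<^sub>\<infinity>i\<in>I. cmod (?a i * cnj (?b i)))"
    unfolding frame_form_def by (rule norm_infsum_bound[OF sm])
  also have "\<dots> \<le> sqrt (L2_sqnorm M f) * sqrt (L2_sqnorm M g)"
    by (rule infsum_le_finite_sums[OF sm]) (rule le)
  finally show "cmod (frame_form f g) \<le> sqrt (L2_sqnorm M f) * sqrt (L2_sqnorm M g)" .
qed

lemma summable_frame_form:
  assumes "sq_integrable M f" "sq_integrable M g"
  shows "(\<lambda>i. L2_inner M f (F i) * cnj (L2_inner M g (F i))) summable_on I"
  by (rule abs_summable_summable[OF frame_form_bounds(1)[OF assms]])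

lemma frame_form_add_left:
  assumes "sq_integrable M f" "sq_integrable M f'" "sq_integrable M g"
  shows "frame_form (\<lambda>x. f x + f' x) g = frame_form f g + frame_form f' g"
  unfolding frame_form_def using assms
  by (subst infsum_add[symmetric])
     (auto intro!: infsum_cong summable_frame_form simp: L2_inner_add_left sq_integrable_F algebra_simps)

lemma frame_form_add_right:
  assumes "sq_integrable M f" "sq_integrable M g" "sq_integrable M g'"
  shows "frame_form f (\<lambda>x. g x + g' x) = frame_form f g + frame_form f g'"
  unfolding frame_form_def using assms
  by (subst infsum_add[symmetric])
     (auto intro!: infsum_cong summable_frame_form simp: L2_inner_add_left sq_integrable_F algebra_simps)

lemma frame_form_cmult_left: "frame_form (\<lambda>x. c * f x) g = c * frame_form f g"
  by (simp add: frame_form_def L2_inner_cmult_left infsum_cmult_right' mult.assoc)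

lemma frame_form_cmult_right: "frame_form f (\<lambda>x. c * g x) = cnj c * frame_form f g"
  by (simp add: frame_form_def L2_inner_cmult_left infsum_cmult_right'[symmetric] mult_ac)

lemma frame_form_self:
  assumes "sq_integrable M f"
  shows "frame_form f f = complex_of_real (energy f)"
proof -
  have "((\<lambda>i. complex_of_real ((cmod (L2_inner M f (F i)))\<^sup>2)) has_sum complex_of_real (energy f)) I"
    using has_sum_bounded_linear[OF bounded_linear_of_real has_sum_infsum[OF summable_energy[OF assms]]]
    by (simp add: energy_def)
  then show ?thesis
    unfolding frame_form_def complex_norm_square by (rule infsumI)
qed

end

subsection \<open>Trigonometric polynomials\<close>

lemma e_exp_add_left: "e_exp (s + t) x = e_exp s x * e_exp t x"
  by (simp add: e_exp_def inner_add_left algebra_simps flip: exp_add)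

lemma e_exp_add_right: "e_exp t (x + y) = e_exp t x * e_exp t y"
  by (simp add: e_exp_def inner_add_right algebra_simps flip: exp_add)

lemma e_exp_0_left [simp]: "e_exp 0 x = 1"
  by (simp add: e_exp_def)

lemma e_exp_commute: "e_exp x y = e_exp y x"
  by (simp add: e_exp_def inner_commute)

lemma e_exp_eq_cis: "e_exp t x = cis (2 * pi * (t \<bullet> x))"
  by (simp add: e_exp_def cis_conv_exp algebra_simps)

lemma cmod_e_exp [simp]: "cmod (e_exp t x) = 1"
  by (simp add: e_exp_eq_cis)

lemma cnj_e_exp: "cnj (e_exp t x) = e_exp (- t) x"
  by (simp add: e_exp_eq_cis cis_cnj)

lemma continuous_on_e_exp: "continuous_on S (e_exp t)"
  unfolding e_exp_def by (intro continuous_intros)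

lemma borel_measurable_e_exp [measurable]: "e_exp t \<in> borel_measurable borel"
  by (intro borel_measurable_continuous_onI continuous_on_e_exp)

text \<open>The complex span of the exponentials with arbitrary real frequencies; rule induction
  transfers properties from exponentials to the span.\<close>

inductive trig_poly :: "(real^'n \<Rightarrow> complex) \<Rightarrow> bool" where
  trig_poly_e_exp: "trig_poly (e_exp t)"
| trig_poly_add: "trig_poly f \<Longrightarrow> trig_poly g \<Longrightarrow> trig_poly (\<lambda>x. f x + g x)"
| trig_poly_cmult: "trig_poly f \<Longrightarrow> trig_poly (\<lambda>x. c * f x)"

lemma trig_poly_mult_e_exp:
  assumes "trig_poly f"
  shows "trig_poly (\<lambda>x. e_exp t x * f x)"
  using assms
proof induction
  case (trig_poly_e_exp s)
  show ?case using trig_poly.trig_poly_e_exp[of "t + s"] by (simp add: e_exp_add_left[abs_def])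
next
  case (trig_poly_add f g)
  then show ?case using trig_poly.trig_poly_add by (fastforce simp: distrib_left)
next
  case (trig_poly_cmult f c)
  then show ?case using trig_poly.trig_poly_cmult[of _ c] by (fastforce simp: mult.left_commute)
qed

lemma trig_poly_mult:
  assumes "trig_poly f" "trig_poly g"
  shows "trig_poly (\<lambda>x. f x * g x)"
  using assms(1)
proof induction
  case (trig_poly_e_exp t)
  show ?case by (rule trig_poly_mult_e_exp[OF assms(2)])
next
  case (trig_poly_add f f')
  then show ?case using trig_poly.trig_poly_add by (fastforce simp: distrib_right)
next
  case (trig_poly_cmult f c)
  then show ?case using trig_poly.trig_poly_cmult[of _ c] by (fastforce simp: mult.assoc)
qed

lemma continuous_on_trig_poly: "trig_poly f \<Longrightarrow> continuous_on S f"
  by (induction rule: trig_poly.induct) (intro continuous_intros continuous_on_e_exp | assumption)+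

lemma trig_poly_const: "trig_poly (\<lambda>x. c)"
  using trig_poly_cmult[OF trig_poly_e_exp[of 0], of c] by simp

text \<open>The real Stone-Weierstrass theorem, applied to the algebra of real functions whose
  complexification is a trigonometric polynomial.\<close>

lemma trig_poly_approx:
  fixes f :: "real^'n \<Rightarrow> real"
  assumes "compact S" "continuous_on S f" "e > 0"
  shows "\<exists>g. trig_poly (\<lambda>x. complex_of_real (g x)) \<and> (\<forall>x\<in>S. \<bar>f x - g x\<bar> < e)"
proof (rule Stone_Weierstrass_HOL[OF assms(1) _ _ _ _ _ assms(2,3)])
  show "trig_poly (\<lambda>x. complex_of_real c)" for c by (rule trig_poly_const)
  show "continuous_on S g" if "trig_poly (\<lambda>x. complex_of_real (g x))" for g
    using continuous_on_Re[OF continuous_on_trig_poly[OF that]] by simp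
  show "trig_poly (\<lambda>x. complex_of_real (g x + h x))"
    if "trig_poly (\<lambda>x. complex_of_real (g x)) \<and> trig_poly (\<lambda>x. complex_of_real (h x))" for g h
    using trig_poly_add[of "\<lambda>x. complex_of_real (g x)" "\<lambda>x. complex_of_real (h x)"] that by simp
  show "trig_poly (\<lambda>x. complex_of_real (g x * h x))"
    if "trig_poly (\<lambda>x. complex_of_real (g x)) \<and> trig_poly (\<lambda>x. complex_of_real (h x))" for g h
    using trig_poly_mult[of "\<lambda>x. complex_of_real (g x)" "\<lambda>x. complex_of_real (h x)"] that by simp
  fix x y :: "real^'n" assume "x \<in> S \<and> y \<in> S \<and> x \<noteq> y"
  then have xy: "x - y \<noteq> 0" by simp
  \<comment> \<open>Scaled so that t . (x - y) = 1/2; the cosine below is then -1 at x and 1 at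
    y.\<close>
  define t where "t = (1 / (2 * ((x - y) \<bullet> (x - y)))) *\<^sub>R (x - y)"
  define g where "g u = cos (2 * pi * (t \<bullet> (u - y)))" for u
  have half: "t \<bullet> (x - y) = 1 / 2" using xy by (simp add: t_def)
  have "g x = -1" unfolding g_def half by simp
  moreover have "g y = 1" by (simp add: g_def)
  moreover have g_eq: "(\<lambda>u. complex_of_real (g u))
      = (\<lambda>u. e_exp t (- y) / 2 * e_exp t u + e_exp (- t) (- y) / 2 * e_exp (- t) u)"
  proof
    fix u
    have "e_exp t (- y) / 2 * e_exp t u + e_exp (- t) (- y) / 2 * e_exp (- t) u
        = (e_exp t (u - y) + cnj (e_exp t (u - y))) / 2"
      using e_exp_add_right[of t u "- y"] e_exp_add_right[of "- t" u "- y"]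
      by (simp add: cnj_e_exp)
    also have "\<dots> = complex_of_real (g u)"
      by (simp add: complex_eq_iff g_def e_exp_eq_cis)
    finally show "complex_of_real (g u) =
      e_exp t (- y) / 2 * e_exp t u + e_exp (- t) (- y) / 2 * e_exp (- t) u" ..
  qed
  moreover have "trig_poly (\<lambda>u. complex_of_real (g u))"
    unfolding g_eq by (intro trig_poly.intros)
  ultimately show "\<exists>f. trig_poly (\<lambda>x. complex_of_real (f x)) \<and> f x \<noteq> f y"
    by (intro exI[of _ g]) simp
qed

subsection \<open>Totality of the exponentials\<close>

locale bounded_bessel_family = bessel_family M I F
  for M :: "(real^'n) measure" and I :: "'i set" and F +
  fixes r :: real
  assumes sets_M: "sets M = sets borel" and M_space: "measure M (space M) = 1"
    and r_nonneg: "r \<ge> 0" and bounded_support: "AE x in M. norm x \<le> r"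
begin

lemma measurable_M_iff: "f \<in> borel_measurable M \<longleftrightarrow> f \<in> borel_measurable borel"
  using measurable_cong_sets[OF sets_M refl] by auto

lemma space_M: "space M = UNIV"
  using sets_eq_imp_space_eq[OF sets_M] by simp

end

text \<open>Separates the density argument from the functional equation: the solution being
  constantly 1 supplies the assumption in the final proof.\<close>

locale exponentials_tight = bounded_bessel_family M I F r
  for M :: "(real^'n) measure" and I :: "'i set" and F and r :: real +
  assumes tight_e_exp: "tight (e_exp t)"
begin

lemma tight_trig_poly: "trig_poly f \<Longrightarrow> tight f"
  by (induction rule: trig_poly.induct) (auto simp: tight_e_exp intro: tight_add tight_cmult)

text \<open>Uniform approximation on the ball of radius r suffices because the ball carries the
  measure; a uniform error \<open>sqrt e\<close> costs e in \<open>L2_sqnorm\<close>.\<close>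

lemma tight_bounded_continuous:
  fixes f :: "real^'n \<Rightarrow> real"
  assumes cont: "continuous_on UNIV f" and bd: "\<And>x. \<bar>f x\<bar> \<le> c"
  shows "tight (\<lambda>x. complex_of_real (f x))"
proof (rule tight_approx)
  have [measurable]: "f \<in> borel_measurable M"
    unfolding measurable_M_iff by (rule borel_measurable_continuous_onI[OF cont])
  show "sq_integrable M (\<lambda>x. complex_of_real (f x))"
    by (rule sq_integrable_AE_bounded[of _ c]) (use bd in auto)
  fix e :: real assume "e > 0"
  then have "sqrt e > 0" by simp
  from trig_poly_approx[OF compact_cball continuous_on_subset[OF cont] this, of 0 r]
  obtain g where g: "trig_poly (\<lambda>x. complex_of_real (g x))"
    and le: "\<forall>x\<in>cball 0 r. \<bar>f x - g x\<bar> < sqrt e" by auto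
  have [measurable]: "(\<lambda>x. complex_of_real (g x)) \<in> borel_measurable M"
    using tight_trig_poly[OF g] by (simp add: tight_def sq_integrable_def)
  have "L2_sqnorm M (\<lambda>x. complex_of_real (f x) - complex_of_real (g x)) \<le> (sqrt e)\<^sup>2"
  proof (rule L2_sqnorm_le_bound[OF _ _ M_space])
    show "AE x in M. cmod (complex_of_real (f x) - complex_of_real (g x)) \<le> sqrt e"
      using bounded_support
    proof eventually_elim
      case (elim x)
      with le have "\<bar>f x - g x\<bar> \<le> sqrt e" by (auto intro: less_imp_le)
      then show ?case by (simp flip: of_real_diff)
    qed
  qed measurable
  with \<open>e > 0\<close> show "\<exists>g. tight g \<and> L2_sqnorm M (\<lambda>x. complex_of_real (f x) - g x) \<le> e"
    using tight_trig_poly[OF g] by auto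
qed

lemma tight_indicator_closed:
  assumes "closed C"
  shows "tight (indicator C)"
proof (cases "C = {}")
  \<comment> \<open>\<open>infdist\<close> to the empty set is 0 by convention, so the ramps used
    below would not tend to the indicator.\<close>
  case True
  then show ?thesis using tight_zero by (simp add: indicator_def[abs_def])
next
  case False
  \<comment> \<open>For n > 0 a continuous ramp from 1 on C down to 0 at distance 1/n.\<close>
  define s where "s n x = max 0 (1 - real n * infdist x C)" for n x
  have le1: "\<bar>s n x\<bar> \<le> 1" for n x by (auto simp: s_def infdist_nonneg)
  have cont: "continuous_on UNIV (s n)" for n
    unfolding s_def by (intro continuous_intros)
  show ?thesis
  proof (rule tight_dominated_limit[of "\<lambda>n x. complex_of_real (s n x)" "\<lambda>x. 1" _ 1])
    show "tight (\<lambda>x. complex_of_real (s n x))" for n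
      by (rule tight_bounded_continuous[OF cont le1])
    show "sq_integrable M (\<lambda>x. 1)" by (rule sq_integrable_const)
    show "(indicator C :: _ \<Rightarrow> complex) \<in> borel_measurable M"
      unfolding measurable_M_iff using assms by (intro borel_measurable_indicator borel_closed)
    show "AE x in M. (\<lambda>n. complex_of_real (s n x)) \<longlonglongrightarrow> indicator C x"
    proof (rule AE_I2)
      fix x
      have "(\<lambda>n. s n x) \<longlonglongrightarrow> indicator C x"
      proof (cases "x \<in> C")
        case True
        then show ?thesis by (simp add: s_def)
      next
        case nC: False
        then have pos: "infdist x C > 0"
          using in_closed_iff_infdist_zero[OF assms False] infdist_nonneg[of x C] by force
        obtain N :: nat where N: "1 < real N * infdist x C"
          using reals_Archimedean3[OF pos] by auto
        have "s n x = 0" if "n \<ge> N" for n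
        proof -
          have "real N * infdist x C \<le> real n * infdist x C"
            using that pos by (intro mult_right_mono) auto
          then show ?thesis using N by (simp add: s_def)
        qed
        then have "eventually (\<lambda>n. s n x = 0) sequentially"
          by (auto simp: eventually_sequentially)
        then show ?thesis using nC by (simp add: tendsto_eventually)
      qed
      then have "(\<lambda>n. complex_of_real (s n x)) \<longlonglongrightarrow> complex_of_real (indicator C x)"
        by (rule tendsto_of_real)
      then show "(\<lambda>n. complex_of_real (s n x)) \<longlonglongrightarrow> indicator C x"
        by (cases "x \<in> C") simp_all
    qed
    show "AE x in M. cmod (complex_of_real (s n x)) \<le> 1 * cmod 1" for n
      using le1 by simp
    show "AE x in M. cmod (indicator C x) \<le> 1 * cmod 1"
      by (simp add: indicator_def)
  qed
qed

text \<open>Closed sets form an intersection-stable generator of the Borel sets, and tightness of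
  indicators passes to complements and countable disjoint unions, so Dynkin's argument
  applies.\<close>

lemma tight_indicator:
  assumes "A \<in> sets M"
  shows "tight (indicator A)"
proof -
  have gen: "sets borel = sigma_sets UNIV (Collect closed :: (real^'n) set set)"
    by (simp add: borel_eq_closed)
  have A: "A \<in> sigma_sets UNIV (Collect closed)"
    using assms by (simp add: sets_M gen)
  have "Int_stable (Collect closed :: (real^'n) set set)"
    by (auto simp: Int_stable_def)
  then show ?thesis using subset_UNIV[of "Collect closed", folded Pow_UNIV] A
  proof (induction rule: sigma_sets_induct_disjoint)
    case (basic A)
    then show ?case by (simp add: tight_indicator_closed)
  next
    case empty
    then show ?case using tight_indicator_closed[OF closed_empty] .
  next
    case (compl A)
    have "tight (\<lambda>x. indicator UNIV x + (-1) * indicator A x)"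
      by (intro tight_add tight_cmult compl tight_indicator_closed) simp
    also have "(\<lambda>x. indicator UNIV x + (-1) * indicator A x :: complex) = indicator (UNIV - A)"
      by (auto simp: indicator_def fun_eq_iff)
    finally show ?case .
  next
    case (union A)
    have meas: "A i \<in> sets M" for i using union(2) by (auto simp: sets_M gen)
    show ?case
    proof (rule tight_dominated_limit[of "\<lambda>n. indicator (\<Union>i<n. A i)" "\<lambda>x. 1" _ 1])
      show "tight (indicator (\<Union>i<n. A i))" for n
      proof -
        have "tight (\<lambda>x. \<Sum>i<n. indicator (A i) x)"
          by (intro tight_sum union)
        also have "(\<lambda>x. \<Sum>i<n. indicator (A i) x :: complex) = indicator (\<Union>i<n. A i)"
          using union(1)
          by (intro ext indicator_UN_disjoint[symmetric]) (auto simp: disjoint_family_on_def)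
        finally show ?thesis .
      qed
      show "sq_integrable M (\<lambda>x. 1)" by (rule sq_integrable_const)
      show "(indicator (\<Union>i. A i) :: _ \<Rightarrow> complex) \<in> borel_measurable M"
        using meas by (intro borel_measurable_indicator sets.countable_UN) auto
      show "AE x in M. (\<lambda>n. indicator (\<Union>i<n. A i) x :: complex) \<longlonglongrightarrow> indicator (\<Union>i. A i) x"
        by (intro AE_I2 LIMSEQ_indicator_UN)
    qed (auto simp: indicator_def)
  qed
qed

text \<open>Simple functions bounded by 2 |f| and converging to f are finite combinations of
  indicators; f itself is the dominating function.\<close>

lemma tight_sq_integrable:
  assumes f: "sq_integrable M f"
  shows "tight f"
proof -
  note [measurable] = sq_integrableD(1)[OF f]
  obtain s where s: "\<And>i. simple_function M (s i)" "\<And>x. (\<lambda>i. s i x) \<longlonglongrightarrow> f x"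
    "\<And>i x. cmod (s i x) \<le> 2 * cmod (f x)"
    using borel_measurable_implies_sequence_metric[OF sq_integrableD(1)[OF f], of 0]
    by (auto simp: space_M)
  have "tight (s i)" for i
  proof -
    have "tight (\<lambda>x. \<Sum>y\<in>s i ` space M. y * indicator (s i -` {y} \<inter> space M) x)"
      using simple_functionD(2)[OF s(1)]
      by (intro tight_sum tight_cmult tight_indicator)
    also have "(\<lambda>x. \<Sum>y\<in>s i ` space M. y * indicator (s i -` {y} \<inter> space M) x) = s i"
    proof
      fix x
      show "(\<Sum>y\<in>s i ` space M. y * indicator (s i -` {y} \<inter> space M) x) = s i x"
        by (subst simple_function_indicator_representation_banach[OF s(1), of x])
           (auto simp: space_M indicator_def intro!: sum.cong)
    qed
    finally show ?thesis .
  qed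
  then show ?thesis
    by (rule tight_dominated_limit[of s f f 2]) (use s f in auto)
qed

lemma energy_eq_L2_sqnorm: "sq_integrable M f \<Longrightarrow> energy f = L2_sqnorm M f"
  using tight_sq_integrable[of f] by (simp add: tight_def defect_def)

end

subsection \<open>Invariance of the measure\<close>

locale self_affine =
  fixes R :: "real^'n^'n" and B :: "(real^'n) set" and \<mu> :: "(real^'n) measure"
  assumes expansive: "expansive R" and finite_B: "finite B" and B_nonempty: "B \<noteq> {}"
    and invariant: "self_affine_measure R B \<mu>"
begin

lemma sets_mu [measurable_cong]: "sets \<mu> = sets borel"
  using invariant by (simp add: self_affine_measure_def)

lemma space_mu: "space \<mu> = UNIV"
  using sets_eq_imp_space_eq[OF sets_mu] by simp

lemma emeasure_space_mu: "emeasure \<mu> (space \<mu>) = 1"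
  using invariant by (simp add: self_affine_measure_def)

sublocale finite_measure \<mu>
  by standard (simp add: emeasure_space_mu)

lemma measure_space_mu: "measure \<mu> (space \<mu>) = 1"
  by (simp add: measure_def emeasure_space_mu)

lemma card_B_pos: "card B > 0"
  using finite_B B_nonempty by (simp add: card_gt_0_iff)

lemma measurable_tau [measurable]: "tau R b \<in> borel_measurable borel"
  unfolding tau_def
  by (intro borel_measurable_continuous_onI linear_continuous_on_compose[OF _ matrix_vector_mul_linear]
      continuous_intros)

lemma vimage_tau_sets: "E \<in> sets borel \<Longrightarrow> tau R b -` E \<in> sets borel"
  using measurable_sets[OF measurable_tau] by simp

lemma measure_invariant:
  "E \<in> sets borel \<Longrightarrow> measure \<mu> E = (\<Sum>b\<in>B. measure \<mu> (tau R b -` E)) / card B"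
  using invariant by (simp add: self_affine_measure_def)

text \<open>Invariance writes N \<mu> as a sum of nonnegative measures, so the image of \<mu> under
  each \<open>tau R b\<close> is at most N \<mu>. This makes compositions with
  \<open>tau R b\<close> integrable.\<close>

lemma nn_integral_tau_le:
  assumes b: "b \<in> B" and [measurable]: "f \<in> borel_measurable borel"
  shows "(\<integral>\<^sup>+x. f (tau R b x) \<partial>\<mu>) \<le> ennreal (card B) * (\<integral>\<^sup>+x. f x \<partial>\<mu>)"
proof -
  have "(\<integral>\<^sup>+x. f (tau R b x) \<partial>\<mu>) = (\<integral>\<^sup>+x. f x \<partial>distr \<mu> borel (tau R b))"
    by (subst nn_integral_distr) auto
  also have "\<dots> \<le> (\<integral>\<^sup>+x. f x \<partial>scale_measure (ennreal (card B)) \<mu>)"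
  proof (rule nn_integral_mono_measure)
    show "sets (distr \<mu> borel (tau R b)) = sets (scale_measure (ennreal (card B)) \<mu>)"
      by (simp add: sets_mu)
    show "distr \<mu> borel (tau R b) \<le> scale_measure (ennreal (card B)) \<mu>"
    proof (subst le_measure)
      show "sets (distr \<mu> borel (tau R b)) = sets (scale_measure (ennreal (card B)) \<mu>)"
        by (simp add: sets_mu)
      show "\<forall>E\<in>sets (distr \<mu> borel (tau R b)).
          emeasure (distr \<mu> borel (tau R b)) E \<le> emeasure (scale_measure (ennreal (card B)) \<mu>) E"
      proof
        fix E assume "E \<in> sets (distr \<mu> borel (tau R b))"
        then have E: "E \<in> sets borel" by simp
        have "measure \<mu> (tau R b -` E) \<le> (\<Sum>b\<in>B. measure \<mu> (tau R b -` E))"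
          using b finite_B by (intro member_le_sum) auto
        also have "\<dots> = card B * measure \<mu> E"
          using measure_invariant[OF E] card_B_pos by simp
        finally have "ennreal (measure \<mu> (tau R b -` E)) \<le> ennreal (card B) * ennreal (measure \<mu> E)"
          by (simp add: ennreal_mult'[symmetric] ennreal_leI)
        then show "emeasure (distr \<mu> borel (tau R b)) E \<le> emeasure (scale_measure (ennreal (card B)) \<mu>) E"
          using E by (simp add: emeasure_distr space_mu emeasure_eq_measure)
      qed
    qed
  qed
  also have "\<dots> = ennreal (card B) * (\<integral>\<^sup>+x. f x \<partial>\<mu>)"
    by (simp add: nn_integral_scale_measure)
  finally show ?thesis .
qed

lemma integrable_tau:
  fixes f :: "real^'n \<Rightarrow> 'b::{banach, second_countable_topology}"
  assumes f: "integrable \<mu> f" and b: "b \<in> B"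
  shows "integrable \<mu> (\<lambda>x. f (tau R b x))"
proof -
  have [measurable]: "f \<in> borel_measurable borel"
    using borel_measurable_integrable[OF f] by simp
  have "(\<integral>\<^sup>+x. ennreal (norm (f (tau R b x))) \<partial>\<mu>) \<le> ennreal (card B) * (\<integral>\<^sup>+x. ennreal (norm (f x)) \<partial>\<mu>)"
    by (rule nn_integral_tau_le[OF b]) measurable
  also have "\<dots> < \<infinity>"
    using f by (simp add: integrable_iff_bounded ennreal_mult_less_top)
  finally show ?thesis
    by (simp add: integrable_iff_bounded)
qed

lemma integral_invariant:
  fixes f :: "real^'n \<Rightarrow> 'b::{banach, second_countable_topology}"
  assumes "integrable \<mu> f"
  shows "(LINT x|\<mu>. f x) = (1 / card B) *\<^sub>R (\<Sum>b\<in>B. LINT x|\<mu>. f (tau R b x))"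
  using assms
proof induction
  case (base A c)
  have [measurable]: "A \<in> sets borel" using base by (simp add: sets_mu)
  have "(LINT x|\<mu>. indicator A (tau R b x) *\<^sub>R c) = measure \<mu> (tau R b -` A) *\<^sub>R c" for b
  proof -
    have "(LINT x|\<mu>. indicator A (tau R b x) *\<^sub>R c) = (LINT x|\<mu>. indicator (tau R b -` A) x *\<^sub>R c)"
      by (simp add: indicator_def)
    also have "\<dots> = measure \<mu> (tau R b -` A) *\<^sub>R c"
      using vimage_tau_sets by (simp add: space_mu sets_mu emeasure_eq_measure)
    finally show ?thesis .
  qed
  moreover have "(LINT x|\<mu>. indicator A x *\<^sub>R c) = measure \<mu> A *\<^sub>R c"
    using base by (simp add: space_mu)
  ultimately show ?case
    by (simp add: measure_invariant scaleR_sum_left[symmetric])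
next
  case (add f g)
  then show ?case
    by (simp add: integrable_tau sum.distrib scaleR_add_right)
next
  case (lim f s)
  have [measurable]: "f \<in> borel_measurable \<mu>" "\<And>i. s i \<in> borel_measurable \<mu>"
    using lim by auto
  \<comment> \<open>This bound dominates the approximants and, composed with \<open>tau R b\<close>,
    stays integrable; it therefore serves for both limits.\<close>
  have bound: "integrable \<mu> (\<lambda>x. 2 * norm (f x))" using lim by simp
  have "(\<lambda>i. LINT x|\<mu>. s i x) \<longlonglongrightarrow> (LINT x|\<mu>. f x)"
    by (rule integral_dominated_convergence[OF _ _ bound]) (use lim in auto)
  moreover have "(\<lambda>i. (1 / card B) *\<^sub>R (\<Sum>b\<in>B. LINT x|\<mu>. s i (tau R b x)))
      \<longlonglongrightarrow> (1 / card B) *\<^sub>R (\<Sum>b\<in>B. LINT x|\<mu>. f (tau R b x))"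
  proof (intro tendsto_scaleR tendsto_const tendsto_sum)
    fix b assume b: "b \<in> B"
    have "(\<lambda>x. f (tau R b x)) \<in> borel_measurable \<mu>" "\<And>i. (\<lambda>x. s i (tau R b x)) \<in> borel_measurable \<mu>"
      by measurable
    then show "(\<lambda>i. LINT x|\<mu>. s i (tau R b x)) \<longlonglongrightarrow> (LINT x|\<mu>. f (tau R b x))"
      by (rule integral_dominated_convergence[OF _ _ integrable_tau[OF bound b]])
         (use lim in \<open>auto simp: space_mu\<close>)
  qed
  ultimately show ?case
    using LIMSEQ_unique by (simp add: lim.IH)
qed

lemma sq_integrable_tau:
  assumes "sq_integrable \<mu> f" "b \<in> B"
  shows "sq_integrable \<mu> (\<lambda>x. f (tau R b x))"
proof -
  have [measurable]: "f \<in> borel_measurable borel"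
    using sq_integrableD(1)[OF assms(1)] by simp
  show ?thesis
    using integrable_tau[OF sq_integrableD(2)[OF assms(1)] assms(2)] by (simp add: sq_integrable_def)
qed

lemma sq_integrable_bounded_mult:
  assumes "sq_integrable \<mu> f" "g \<in> borel_measurable borel" "\<And>x. cmod (g x) \<le> 1"
  shows "sq_integrable \<mu> (\<lambda>x. g x * f x)"
proof (rule sq_integrable_dominated[OF assms(1), of _ 1])
  show "AE x in \<mu>. cmod (g x * f x) \<le> 1 * cmod (f x)"
    using assms(3) by (auto simp: norm_mult mult_left_le_one_le)
qed (use assms in \<open>auto simp: sq_integrable_def\<close>)

lemma sq_integrable_e_exp: "sq_integrable \<mu> (e_exp t)"
  by (rule sq_integrable_AE_bounded[of _ 1]) auto

lemma R_matrix_inv: "R ** matrix_inv R = mat 1"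
  by (rule matrix_inv_right[OF expansive_imp_invertible[OF expansive]])

lemma transpose_R_matrix_inv: "transpose R ** matrix_inv (transpose R) = mat 1"
  using expansive_imp_invertible[OF expansive]
  by (intro matrix_inv_right) (simp add: invertible_det_nz)

lemma R_tau: "R *v tau R b x = x + b"
  by (simp add: tau_def matrix_vector_mul_assoc R_matrix_inv)

lemma inner_transpose: "(transpose R *v k) \<bullet> y = k \<bullet> (R *v y)"
  by (simp add: dot_lmul_matrix)

lemma e_exp_transpose_tau: "e_exp (transpose R *v k) (tau R b x) = e_exp k (x + b)"
  unfolding e_exp_def inner_transpose R_tau ..

lemma e_exp_tau: "e_exp t (tau R b x) = e_exp (matrix_inv (transpose R) *v t) (x + b)"
proof -
  have "t = transpose R *v (matrix_inv (transpose R) *v t)"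
    by (simp add: matrix_vector_mul_assoc transpose_R_matrix_inv del: transpose_matrix_vector)
  then show ?thesis by (metis e_exp_transpose_tau)
qed

end

subsection \<open>The operators\<close>

text \<open>The inner sum is the conjugate of the l-th entry of T applied to the conjugate of v.
  Expanding the squares produces the entries of T*T = I.\<close>

lemma orthonormal_columns_isometry:
  fixes T :: "'l \<Rightarrow> 'b \<Rightarrow> complex"
  assumes B: "finite B"
    and orth: "\<And>b b'. b \<in> B \<Longrightarrow> b' \<in> B \<Longrightarrow> (\<Sum>l\<in>L. cnj (T l b) * T l b') = (if b = b' then 1 else 0)"
  shows "(\<Sum>l\<in>L. (cmod (\<Sum>b\<in>B. cnj (T l b) * v b))\<^sup>2) = (\<Sum>b\<in>B. (cmod (v b))\<^sup>2)"
proof -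
  have "complex_of_real (\<Sum>l\<in>L. (cmod (\<Sum>b\<in>B. cnj (T l b) * v b))\<^sup>2)
     = (\<Sum>l\<in>L. \<Sum>b\<in>B. \<Sum>b'\<in>B. (v b * cnj (v b')) * (cnj (T l b) * T l b'))"
    unfolding of_real_sum complex_norm_square cnj_sum sum_product
    by (simp add: mult_ac)
  also have "\<dots> = (\<Sum>b\<in>B. \<Sum>b'\<in>B. (v b * cnj (v b')) * (\<Sum>l\<in>L. cnj (T l b) * T l b'))"
    unfolding sum_distrib_left
    by (subst sum.swap, intro sum.cong refl, subst sum.swap) simp
  also have "\<dots> = (\<Sum>b\<in>B. \<Sum>b'\<in>B. if b = b' then v b * cnj (v b') else 0)"
    by (intro sum.cong refl) (simp add: orth)
  also have "\<dots> = complex_of_real (\<Sum>b\<in>B. (cmod (v b))\<^sup>2)"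
    using B unfolding of_real_sum complex_norm_square by (simp add: sum.delta)
  finally show ?thesis by (simp only: of_real_eq_iff)
qed

section \<open>Integer frequencies and the recursion over words\<close>

lemma int_vec_e_exp:
  assumes "int_vec k" "int_vec b"
  shows "e_exp k b = 1"
proof -
  have "k \<bullet> b \<in> \<int>"
    unfolding inner_vec_def using assms by (auto simp: int_vec_def intro!: Ints_sum Ints_mult)
  then obtain n where "k \<bullet> b = of_int n" by (elim Ints_cases)
  then show ?thesis
    using cis_multiple_2pi[of "of_int n"] by (simp add: e_exp_eq_cis mult_ac)
qed

lemma word_freq_Nil [simp]: "word_freq R [] = 0"
  by (simp add: word_freq_def)

text \<open>Horner's scheme, which splits off the first letter.\<close>

lemma word_freq_Cons: "word_freq R (l # w) = l + transpose R *v word_freq R w"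
  unfolding word_freq_def length_Cons sum.lessThan_Suc_shift
  by (simp add: linear_sum[OF matrix_vector_mul_linear] matrix_vector_mul_assoc del: transpose_matrix_vector)

lemma word_coeff_Nil [simp]: "word_coeff \<alpha> [] = 1"
  by (simp add: word_coeff_def)

lemma word_coeff_Cons: "word_coeff \<alpha> (l # w) = \<alpha> l * word_coeff \<alpha> w"
  unfolding word_coeff_def length_Cons prod.lessThan_Suc_shift by simp

lemma int_vec_word_freq:
  assumes "int_matrix R" "\<And>l. l \<in> set w \<Longrightarrow> int_vec l"
  shows "int_vec (word_freq R w)"
  using assms(2)
proof (induction w)
  case (Cons l w)
  have "int_vec (transpose R *v word_freq R w)"
    using Cons assms(1) unfolding int_vec_def int_matrix_def transpose_def matrix_vector_mult_def
    by (auto intro!: Ints_sum Ints_mult)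
  then show ?case using Cons.prems by (auto simp: word_freq_Cons int_vec_def simp del: transpose_matrix_vector)
qed (simp add: int_vec_def)

text \<open>Words in \<^term>\<open>Omega L\<close> correspond to infinite words that are eventually 0; prepending the
  letter 0 to the infinite word 000... gives that word again, hence the exceptional value.\<close>

definition prepend :: "(real^'n) \<times> (real^'n) list \<Rightarrow> (real^'n) list" where
  "prepend = (\<lambda>(l, w). if l = 0 \<and> w = [] then [] else l # w)"

lemma inj_prepend: "inj prepend"
  by (auto simp: inj_def prepend_def split: if_splits)

text \<open>The length bound drives the induction in \<open>bessel_Omega_le\<close>, and the union
  over n gives \<open>bij_betw_prepend\<close>. The empty word comes from the pair (0, []), which
  needs 0 in L.\<close>

lemma prepend_image_Omega:
  assumes "0 \<in> L"
  shows "prepend ` (L \<times> {w \<in> Omega L. length w \<le> n}) = {w \<in> Omega L. length w \<le> Suc n}"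
proof (intro equalityI subsetI)
  fix w assume "w \<in> prepend ` (L \<times> {w \<in> Omega L. length w \<le> n})"
  then show "w \<in> {w \<in> Omega L. length w \<le> Suc n}"
    by (auto simp: prepend_def Omega_def split: if_splits)
next
  fix w assume w: "w \<in> {w \<in> Omega L. length w \<le> Suc n}"
  show "w \<in> prepend ` (L \<times> {w \<in> Omega L. length w \<le> n})"
  proof (cases w)
    case Nil
    then show ?thesis using assms by (intro image_eqI[of _ _ "(0, [])"]) (auto simp: prepend_def Omega_def)
  next
    case (Cons l w')
    then show ?thesis using w
      by (intro image_eqI[of _ _ "(l, w')"]) (auto simp: prepend_def Omega_def split: if_splits)
  qed
qed

lemma bij_betw_prepend:
  assumes "0 \<in> L"
  shows "bij_betw prepend (L \<times> Omega L) (Omega L)"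
proof -
  have "prepend ` (L \<times> Omega L) = (\<Union>n. prepend ` (L \<times> {w \<in> Omega L. length w \<le> n}))"
    by blast
  also have "\<dots> = (\<Union>n. {w \<in> Omega L. length w \<le> Suc n})"
    unfolding prepend_image_Omega[OF assms] ..
  also have "\<dots> = Omega L" by (auto intro: le_SucI)
  finally show ?thesis
    using inj_on_subset[OF inj_prepend] by (simp add: bij_betw_def)
qed

section \<open>The isometry formed by the operators and Bessel's inequality\<close>

locale weighted_fourier = self_affine R B \<mu>
  for R :: "real^'n^'n" and B :: "(real^'n) set" and \<mu> :: "(real^'n) measure" +
  fixes L :: "(real^'n) set" and \<alpha> :: "real^'n \<Rightarrow> complex"
  assumes int_R: "int_matrix R" and int_B: "b \<in> B \<Longrightarrow> int_vec b"
    and finite_L: "finite L" and int_L: "l \<in> L \<Longrightarrow> int_vec l" and zero_L: "0 \<in> L"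
    and alpha_0: "\<alpha> 0 = 1"
    and orthonormal_columns: "b \<in> B \<Longrightarrow> b' \<in> B \<Longrightarrow>
      (\<Sum>l\<in>L. cnj (e_exp (matrix_inv (transpose R) *v l) b * \<alpha> l / sqrt (real (card B)))
        * (e_exp (matrix_inv (transpose R) *v l) b' * \<alpha> l / sqrt (real (card B))))
      = (if b = b' then 1 else 0)"
begin

definition wexp :: "(real^'n) list \<Rightarrow> real^'n \<Rightarrow> complex" where
  "wexp w x = word_coeff \<alpha> w * e_exp (word_freq R w) x"

text \<open>The adjoint of \<open>g \<mapsto> \<alpha>\<^sub>l e\<^sub>l (g \<circ> \<sigma>)\<close>, where \<open>\<sigma>\<close> is the
  left inverse of all the \<open>\<tau>\<^sub>b\<close>.\<close>

definition descend :: "real^'n \<Rightarrow> (real^'n \<Rightarrow> complex) \<Rightarrow> real^'n \<Rightarrow> complex" where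
  "descend l f x = cnj (\<alpha> l) / card B * (\<Sum>b\<in>B. cnj (e_exp l (tau R b x)) * f (tau R b x))"

lemma sq_integrable_wexp: "sq_integrable \<mu> (wexp w)"
  unfolding wexp_def by (rule sq_integrable_cmult[OF sq_integrable_e_exp])

lemma sq_integrable_descend_summand:
  assumes "sq_integrable \<mu> f" "b \<in> B"
  shows "sq_integrable \<mu> (\<lambda>x. cnj (e_exp l (tau R b x)) * f (tau R b x))"
  by (rule sq_integrable_bounded_mult[OF sq_integrable_tau[OF assms]]) auto

lemma sq_integrable_descend:
  assumes "sq_integrable \<mu> f"
  shows "sq_integrable \<mu> (descend l f)"
  unfolding descend_def
  by (intro sq_integrable_cmult sq_integrable_sum sq_integrable_descend_summand assms)

text \<open>The exponential e_l at \<open>tau R b x\<close> is the exponential of frequency (R^T)^-1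
  l at x + b. So up to a factor of modulus 1, \<open>descend l f x\<close> is 1 / sqrt N times the
  l-th inner sum of \<open>orthonormal_columns_isometry\<close> with v b = f (tau R b x).\<close>

lemma sum_cmod_descend:
  "(\<Sum>l\<in>L. (cmod (descend l f x))\<^sup>2) = (1 / card B) * (\<Sum>b\<in>B. (cmod (f (tau R b x)))\<^sup>2)"
proof -
  define N where "N = real (card B)"
  have N: "N > 0" using card_B_pos by (simp add: N_def)
  define T where "T l b = e_exp (matrix_inv (transpose R) *v l) b * \<alpha> l / complex_of_real (sqrt N)" for l b
  have "(cmod (descend l f x))\<^sup>2 = (1 / N) * (cmod (\<Sum>b\<in>B. cnj (T l b) * f (tau R b x)))\<^sup>2" for l
  proof -
    have sq: "complex_of_real (sqrt N) * complex_of_real (sqrt N) = complex_of_real N"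
      using N by (simp flip: of_real_mult)
    have "descend l f x = cnj (\<alpha> l) / complex_of_real N * (\<Sum>b\<in>B. cnj (e_exp (matrix_inv (transpose R) *v l) x)
        * (cnj (e_exp (matrix_inv (transpose R) *v l) b) * f (tau R b x)))"
      unfolding descend_def e_exp_tau e_exp_add_right by (simp add: N_def mult.assoc)
    also have "\<dots> = cnj (e_exp (matrix_inv (transpose R) *v l) x) / complex_of_real (sqrt N)
        * (\<Sum>b\<in>B. cnj (T l b) * f (tau R b x))"
      unfolding T_def sum_distrib_left sq[symmetric] by (intro sum.cong refl) (simp add: field_simps)
    finally show ?thesis
      using N by (simp add: norm_mult norm_divide power_mult_distrib power_divide)
  qed
  then have "(\<Sum>l\<in>L. (cmod (descend l f x))\<^sup>2)
      = (1 / N) * (\<Sum>l\<in>L. (cmod (\<Sum>b\<in>B. cnj (T l b) * f (tau R b x)))\<^sup>2)"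
    by (simp add: sum_distrib_left)
  also have "(\<Sum>l\<in>L. (cmod (\<Sum>b\<in>B. cnj (T l b) * f (tau R b x)))\<^sup>2) = (\<Sum>b\<in>B. (cmod (f (tau R b x)))\<^sup>2)"
    by (rule orthonormal_columns_isometry[OF finite_B])
       (use orthonormal_columns in \<open>simp add: T_def N_def\<close>)
  finally show ?thesis by (simp add: N_def)
qed

text \<open>Integrate the pointwise identity and undo the average over B by invariance.\<close>

lemma sum_L2_sqnorm_descend:
  assumes f: "sq_integrable \<mu> f"
  shows "(\<Sum>l\<in>L. L2_sqnorm \<mu> (descend l f)) = L2_sqnorm \<mu> f"
proof -
  have "(\<Sum>l\<in>L. L2_sqnorm \<mu> (descend l f)) = (LINT x|\<mu>. (\<Sum>l\<in>L. (cmod (descend l f x))\<^sup>2))"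
    unfolding L2_sqnorm_def
    by (intro Bochner_Integration.integral_sum[symmetric] sq_integrableD(2) sq_integrable_descend f)
  also have "\<dots> = (1 / card B) * (\<Sum>b\<in>B. LINT x|\<mu>. (cmod (f (tau R b x)))\<^sup>2)"
    unfolding sum_cmod_descend using sq_integrableD(2)[OF sq_integrable_tau[OF f]]
    by (simp add: Bochner_Integration.integral_sum)
  also have "\<dots> = L2_sqnorm \<mu> f"
    unfolding L2_sqnorm_def using integral_invariant[OF sq_integrableD(2)[OF f]] by simp
  finally show ?thesis .
qed

text \<open>Invariance turns the integral into an average over b, in which the tail of the word
  contributes a factor independent of b; the rest of the average is
  \<open>descend l f\<close>.\<close>

lemma L2_inner_wexp_Cons:
  assumes f: "sq_integrable \<mu> f" and w: "set w \<subseteq> L"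
  shows "L2_inner \<mu> f (wexp (l # w)) = L2_inner \<mu> (descend l f) (wexp w)"
proof -
  have shift: "wexp (l # w) (tau R b x) = \<alpha> l * e_exp l (tau R b x) * wexp w x" if "b \<in> B" for b x
  proof -
    \<comment> \<open>Both vectors are integral, so the tail exponential does not see the
      translation by b.\<close>
    have "e_exp (word_freq R w) b = 1"
      using int_vec_e_exp int_vec_word_freq[OF int_R] int_L int_B w that by blast
    then show ?thesis
      unfolding wexp_def word_coeff_Cons word_freq_Cons e_exp_add_left e_exp_transpose_tau
      by (simp add: e_exp_add_right)
  qed
  let ?h = "\<lambda>b x. (cnj (e_exp l (tau R b x)) * f (tau R b x)) * cnj (wexp w x)"
  have "L2_inner \<mu> f (wexp (l # w))
      = (1 / card B) *\<^sub>R (\<Sum>b\<in>B. LINT x|\<mu>. f (tau R b x) * cnj (wexp (l # w) (tau R b x)))"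
    unfolding L2_inner_def
    by (rule integral_invariant[OF integrable_mult_cnj[OF f sq_integrable_wexp]])
  also have "\<dots> = (1 / card B) *\<^sub>R (\<Sum>b\<in>B. LINT x|\<mu>. cnj (\<alpha> l) * ?h b x)"
    by (simp add: shift mult_ac)
  also have "\<dots> = cnj (\<alpha> l) / card B * (\<Sum>b\<in>B. LINT x|\<mu>. ?h b x)"
    by (simp add: scaleR_conv_of_real sum_distrib_left)
  also have "(\<Sum>b\<in>B. LINT x|\<mu>. ?h b x) = (LINT x|\<mu>. (\<Sum>b\<in>B. ?h b x))"
    by (intro Bochner_Integration.integral_sum[symmetric] integrable_mult_cnj
        sq_integrable_descend_summand f sq_integrable_wexp)
  also have "cnj (\<alpha> l) / card B * \<dots> = L2_inner \<mu> (descend l f) (wexp w)"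
    unfolding L2_inner_def descend_def
    by (simp add: sum_distrib_right mult.assoc flip: integral_mult_right_zero)
  finally show ?thesis .
qed

text \<open>The conjugate of e_l shifts the frequency to t - l, and composition with
  \<open>tau R b\<close> moves it to (R^T)^-1 (t - l), leaving factors in b whose average is
  \<open>m_B\<close>.\<close>

lemma descend_e_exp:
  "descend l (e_exp t) x = cnj (\<alpha> l) * m_B B (matrix_inv (transpose R) *v (t - l))
    * e_exp (matrix_inv (transpose R) *v (t - l)) x"
proof -
  let ?s = "matrix_inv (transpose R) *v (t - l)"
  have eq: "cnj (e_exp l y) * e_exp t y = e_exp (t - l) y" for y
    using e_exp_add_left[of "- l" t y] by (simp add: cnj_e_exp)
  have "descend l (e_exp t) x = cnj (\<alpha> l) / card B * (\<Sum>b\<in>B. e_exp ?s (x + b))"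
    unfolding descend_def eq by (simp only: e_exp_tau)
  also have "\<dots> = cnj (\<alpha> l) * m_B B ?s * e_exp ?s x"
    unfolding m_B_def e_exp_add_right
    by (simp add: sum_distrib_left sum_distrib_right e_exp_commute[of _ ?s] mult_ac)
  finally show ?thesis .
qed

text \<open>Only the pair (0, []) is exceptional; there \<alpha> 0 = 1 and the frequency 0 make both
  sides the constant 1.\<close>

lemma wexp_prepend: "wexp (prepend (l, w)) = wexp (l # w)"
  by (auto simp: prepend_def wexp_def[abs_def] word_coeff_Cons word_freq_Cons alpha_0)

lemma finite_Omega_le: "finite {w \<in> Omega L. length w \<le> n}"
  by (rule finite_subset[OF _ finite_lists_length_le[OF finite_L, of n]]) (auto simp: Omega_def)

text \<open>The function varies in the induction because the hypothesis is applied to every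
  \<open>descend l f\<close>. At length 0 only the empty word is left.\<close>

lemma bessel_Omega_le:
  assumes "sq_integrable \<mu> f"
  shows "(\<Sum>w | w \<in> Omega L \<and> length w \<le> n. (cmod (L2_inner \<mu> f (wexp w)))\<^sup>2) \<le> L2_sqnorm \<mu> f"
  using assms
proof (induction n arbitrary: f)
  case 0
  have "{w \<in> Omega L. length w \<le> 0} = {[]}" by (auto simp: Omega_def)
  then show ?case
    using integral_square_le_L2_sqnorm[OF 0 measure_space_mu]
    by (simp add: L2_inner_def wexp_def)
next
  case (Suc n)
  let ?O = "{w \<in> Omega L. length w \<le> n}"
  have "(\<Sum>w | w \<in> Omega L \<and> length w \<le> Suc n. (cmod (L2_inner \<mu> f (wexp w)))\<^sup>2)
      = (\<Sum>p\<in>L \<times> ?O. (cmod (L2_inner \<mu> f (wexp (prepend p))))\<^sup>2)"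
    unfolding prepend_image_Omega[OF zero_L, symmetric]
    by (subst sum.reindex[OF inj_on_subset[OF inj_prepend]]) auto
  also have "\<dots> = (\<Sum>l\<in>L. \<Sum>w\<in>?O. (cmod (L2_inner \<mu> f (wexp (prepend (l, w)))))\<^sup>2)"
    by (simp add: sum.cartesian_product)
  also have "\<dots> = (\<Sum>l\<in>L. \<Sum>w\<in>?O. (cmod (L2_inner \<mu> (descend l f) (wexp w)))\<^sup>2)"
    unfolding wexp_prepend
    by (intro sum.cong refl) (auto simp: L2_inner_wexp_Cons[OF Suc.prems] Omega_def)
  also have "\<dots> \<le> (\<Sum>l\<in>L. L2_sqnorm \<mu> (descend l f))"
    by (intro sum_mono Suc.IH sq_integrable_descend Suc.prems)
  also have "\<dots> = L2_sqnorm \<mu> f" by (rule sum_L2_sqnorm_descend[OF Suc.prems])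
  finally show ?case .
qed

sublocale bessel_family \<mu> "Omega L" wexp
proof
  show "sq_integrable \<mu> (wexp w)" for w by (rule sq_integrable_wexp)
  fix f J assume f: "sq_integrable \<mu> f" and J: "finite J" "J \<subseteq> Omega L"
  \<comment> \<open>Finitely many words have bounded length, which reduces the claim to
    \<open>bessel_Omega_le\<close>.\<close>
  obtain n where n: "\<And>w. w \<in> J \<Longrightarrow> length w \<le> n"
    using finite_nat_set_iff_bounded_le[of "length ` J"] J by auto
  have "(\<Sum>w\<in>J. (cmod (L2_inner \<mu> f (wexp w)))\<^sup>2)
      \<le> (\<Sum>w | w \<in> Omega L \<and> length w \<le> n. (cmod (L2_inner \<mu> f (wexp w)))\<^sup>2)"
    using finite_Omega_le n J by (intro sum_mono2) auto
  with bessel_Omega_le[OF f] show "(\<Sum>w\<in>J. (cmod (L2_inner \<mu> f (wexp w)))\<^sup>2) \<le> L2_sqnorm \<mu> f"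
    by (rule order_trans[rotated])
qed

section \<open>The functional equation for the energy of the exponentials\<close>

lemma energy_refine:
  assumes f: "sq_integrable \<mu> f"
  shows "energy f = (\<Sum>l\<in>L. energy (descend l f))"
proof -
  let ?c = "\<lambda>w. (cmod (L2_inner \<mu> f (wexp w)))\<^sup>2"
  have bij: "bij_betw prepend (L \<times> Omega L) (Omega L)"
    by (rule bij_betw_prepend[OF zero_L])
  have sm: "(\<lambda>p. ?c (prepend p)) summable_on L \<times> Omega L"
    unfolding summable_on_reindex_bij_betw[OF bij, of ?c] by (rule summable_energy[OF f])
  have "energy f = (\<Sum>\<^sub>\<infinity>p\<in>L \<times> Omega L. ?c (prepend p))"
    unfolding energy_def by (rule infsum_reindex_bij_betw[OF bij, symmetric])
  also have "\<dots> = (\<Sum>l\<in>L. \<Sum>\<^sub>\<infinity>w\<in>Omega L. ?c (prepend (l, w)))"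
    using infsum_Sigma_banach[OF sm] finite_L by simp
  also have "\<dots> = (\<Sum>l\<in>L. energy (descend l f))"
    unfolding energy_def wexp_prepend
    by (intro sum.cong infsum_cong refl) (auto simp: L2_inner_wexp_Cons[OF f] Omega_def)
  finally show ?thesis .
qed

text \<open>This is the equation of hypothesis (iii) for the function t |-> energy (e_t).\<close>

lemma energy_e_exp_refine:
  "energy (e_exp t) = (\<Sum>l\<in>L. (cmod (\<alpha> l))\<^sup>2 * (cmod (m_B B (matrix_inv (transpose R) *v (t - l))))\<^sup>2
    * energy (e_exp (matrix_inv (transpose R) *v (t - l))))"
  by (subst energy_refine[OF sq_integrable_e_exp])
     (simp add: descend_e_exp[abs_def] energy_cmult norm_mult power_mult_distrib)

lemma L2_sqnorm_e_exp: "L2_sqnorm \<mu> (e_exp t) = 1"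
  using measure_space_mu by (simp add: L2_sqnorm_def)

lemma energy_e_exp_le: "energy (e_exp t) \<le> 1"
  using energy_le_L2_sqnorm[OF sq_integrable_e_exp] by (simp add: L2_sqnorm_e_exp)

text \<open>The empty word alone contributes 1, and Bessel's inequality allows no more.\<close>

lemma energy_e_exp_0: "energy (e_exp 0) = 1"
proof -
  have "(\<Sum>w\<in>{[]}. (cmod (L2_inner \<mu> (e_exp 0) (wexp w)))\<^sup>2) \<le> energy (e_exp 0)"
    unfolding energy_def
    by (rule finite_sum_le_infsum[OF summable_energy[OF sq_integrable_e_exp]]) (auto simp: Omega_def)
  then show ?thesis
    using energy_e_exp_le[of 0] measure_space_mu by (simp add: L2_inner_def wexp_def)
qed

end

subsection \<open>Entire extension of the energy of the exponentials\<close>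

text \<open>Bilinear rather than Hermitian, so that \<open>cexp z x\<close> is holomorphic in
  z.\<close>

definition cdot :: "complex^'n \<Rightarrow> real^'n \<Rightarrow> complex" where
  "cdot z x = (\<Sum>i\<in>UNIV. z $ i * complex_of_real (x $ i))"

definition cexp :: "complex^'n \<Rightarrow> real^'n \<Rightarrow> complex" where
  "cexp z x = exp (2 * pi * \<i> * cdot z x)"

text \<open>The differential of w |-> cexp w x at z in direction v; \<open>cexp_rem\<close> is the
  exact remainder.\<close>

definition cexp_deriv :: "complex^'n \<Rightarrow> complex^'n \<Rightarrow> real^'n \<Rightarrow> complex" where
  "cexp_deriv z v x = 2 * pi * \<i> * cdot v x * cexp z x"

definition cexp_rem :: "complex^'n \<Rightarrow> complex^'n \<Rightarrow> real^'n \<Rightarrow> complex" where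
  "cexp_rem z v x = (cexp v x - 1 - 2 * pi * \<i> * cdot v x) * cexp z x"

text \<open>Placed in the antilinear slot of \<open>frame_form\<close>, this conjugation restores
  complex linearity; it fixes real points.\<close>

definition vcnj :: "complex^'n \<Rightarrow> complex^'n" where
  "vcnj z = (\<chi> i. cnj (z $ i))"

lemma vcnj_add: "vcnj (z + w) = vcnj z + vcnj w"
  by (simp add: vcnj_def vec_eq_iff)

lemma vcnj_smult: "vcnj (c *s z) = cnj c *s vcnj z"
  by (simp add: vcnj_def vec_eq_iff)

lemma norm_vcnj: "norm (vcnj z) = norm z"
  by (simp add: vcnj_def norm_vec_def L2_set_def)

lemma vcnj_cvec: "vcnj (cvec t) = cvec t"
  by (simp add: vcnj_def cvec_def vec_eq_iff)

lemma cdot_add: "cdot (z + w) x = cdot z x + cdot w x"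
  by (simp add: cdot_def algebra_simps sum.distrib)

lemma cdot_smult: "cdot (c *s z) x = c * cdot z x"
  by (simp add: cdot_def sum_distrib_left mult.assoc)

lemma cmod_cdot_le: "cmod (cdot z x) \<le> norm z * norm x"
proof -
  have "cmod (cdot z x) \<le> (\<Sum>i\<in>UNIV. \<bar>cmod (z $ i)\<bar> * \<bar>norm (x $ i)\<bar>)"
    unfolding cdot_def by (rule order_trans[OF norm_sum]) (simp add: norm_mult)
  also have "\<dots> \<le> L2_set (\<lambda>i. cmod (z $ i)) UNIV * L2_set (\<lambda>i. norm (x $ i)) UNIV"
    by (rule L2_set_mult_ineq)
  finally show ?thesis by (simp add: norm_vec_def)
qed

lemma cexp_add: "cexp (z + w) x = cexp z x * cexp w x"
  by (simp add: cexp_def cdot_add distrib_left exp_add)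

lemma cexp_cvec: "cexp (cvec t) = e_exp t"
  by (simp add: fun_eq_iff cexp_def e_exp_def cdot_def cvec_def inner_vec_def)

lemma cexp_expand: "cexp (z + v) = (\<lambda>x. (cexp z x + cexp_deriv z v x) + cexp_rem z v x)"
  by (simp add: fun_eq_iff cexp_add cexp_deriv_def cexp_rem_def algebra_simps)

lemma continuous_on_cdot: "continuous_on S (cdot z)"
  unfolding cdot_def by (intro continuous_intros)

lemma borel_measurable_cexp [measurable]:
  "cdot z \<in> borel_measurable borel" "cexp z \<in> borel_measurable borel"
  "cexp_deriv z v \<in> borel_measurable borel" "cexp_rem z v \<in> borel_measurable borel"
  unfolding cexp_rem_def cexp_deriv_def cexp_def
  by (intro borel_measurable_continuous_onI continuous_intros continuous_on_cdot)+

lemma cmod_2_pi_i_cdot_le: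
  assumes "norm x \<le> r"
  shows "cmod (2 * pi * \<i> * cdot z x) \<le> 2 * pi * r * norm z"
proof -
  have "cmod (cdot z x) \<le> norm z * r"
    by (rule order_trans[OF cmod_cdot_le mult_left_mono]) (use assms in auto)
  then show ?thesis by (simp add: norm_mult mult_ac)
qed

lemma cmod_cexp_le:
  assumes "norm x \<le> r"
  shows "cmod (cexp z x) \<le> exp (2 * pi * r * norm z)"
  unfolding cexp_def
  by (rule order_trans[OF norm_exp]) (use cmod_2_pi_i_cdot_le[OF assms] in simp)

text \<open>One constant serves all three bounds. It depends on z only through its norm, hence
  serves at \<open>vcnj z\<close> too. The remainder rests on |exp u - 1 - u| <= exp |Re u|
  |u|^2.\<close>

lemma cmod_cexp_bounds:
  assumes x: "norm x \<le> r" and v: "norm v \<le> 1"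
    and C_def: "C = (1 + 2 * pi * r + (2 * pi * r)\<^sup>2 * exp (2 * pi * r)) * exp (2 * pi * r * norm z)"
  shows "cmod (cexp z x) \<le> C" "cmod (cexp_deriv z v x) \<le> C * norm v"
    "cmod (cexp_rem z v x) \<le> C * (norm v)\<^sup>2"
proof -
  define c where "c = 2 * pi * r"
  have "r \<ge> 0" using x norm_ge_zero order_trans by blast
  then have c: "c \<ge> 0" by (simp add: c_def)
  define u where "u = 2 * pi * \<i> * cdot v x"
  have u: "cmod u \<le> c * norm v" unfolding u_def c_def by (rule cmod_2_pi_i_cdot_le[OF x])
  have E: "cmod (cexp z x) \<le> exp (c * norm z)" unfolding c_def by (rule cmod_cexp_le[OF x])
  have C: "C = (1 + c + c\<^sup>2 * exp c) * exp (c * norm z)" by (simp add: C_def c_def)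
  have le: "K * exp (c * norm z) \<le> C" if "K \<le> 1 + c + c\<^sup>2 * exp c" for K
    unfolding C using that by (intro mult_right_mono) auto
  show "cmod (cexp z x) \<le> C" using E le[of 1] c by simp
  have "cmod (cexp_deriv z v x) \<le> (c * norm v) * exp (c * norm z)"
    unfolding cexp_deriv_def u_def[symmetric] norm_mult using u E c by (intro mult_mono) auto
  also have "\<dots> = (c * exp (c * norm z)) * norm v" by simp
  also have "\<dots> \<le> C * norm v" using c by (intro mult_right_mono le) auto
  finally show "cmod (cexp_deriv z v x) \<le> C * norm v" .
  have "cmod (exp u - 1 - u) \<le> exp \<bar>Re u\<bar> * (cmod u)\<^sup>2"
    using Taylor_exp[of u 1] by (simp add: algebra_simps numeral_2_eq_2)
  also have "\<dots> \<le> exp c * (c * norm v)\<^sup>2"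
  proof (intro mult_mono power_mono u)
    have "c * norm v \<le> c * 1" using v c by (intro mult_left_mono) auto
    then show "exp \<bar>Re u\<bar> \<le> exp c" using abs_Re_le_cmod[of u] u by simp
  qed auto
  finally have rem: "cmod (cexp v x - 1 - 2 * pi * \<i> * cdot v x) \<le> exp c * (c * norm v)\<^sup>2"
    by (simp add: u_def cexp_def)
  have "cmod (cexp_rem z v x) \<le> (exp c * (c * norm v)\<^sup>2) * exp (c * norm z)"
    unfolding cexp_rem_def norm_mult[of "cexp v x - 1 - 2 * pi * \<i> * cdot v x"]
    using rem E by (intro mult_mono) auto
  also have "\<dots> = (c\<^sup>2 * exp c * exp (c * norm z)) * (norm v)\<^sup>2"
    by (simp add: power_mult_distrib)
  also have "\<dots> \<le> C * (norm v)\<^sup>2" using c by (intro mult_right_mono le) auto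
  finally show "cmod (cexp_rem z v x) \<le> C * (norm v)\<^sup>2" .
qed

lemma has_derivative_quadratic_remainder:
  fixes f :: "'a::real_normed_vector \<Rightarrow> 'b::real_normed_vector"
  assumes "bounded_linear D"
    and le: "\<And>v. norm v \<le> 1 \<Longrightarrow> norm (f (z + v) - f z - D v) \<le> K * (norm v)\<^sup>2"
  shows "(f has_derivative D) (at z)"
  unfolding has_derivative_at
proof (intro conjI assms(1))
  have "((\<lambda>v::'a. K * norm v) \<longlongrightarrow> K * norm (0::'a)) (at 0)"
    by (intro tendsto_intros)
  then have lim: "((\<lambda>v::'a. K * norm v) \<longlongrightarrow> 0) (at 0)" by simp
  have "eventually (\<lambda>v::'a. v \<in> ball 0 1) (at 0)"
    by (intro eventually_at_in_open') auto
  then have "eventually (\<lambda>v. norm (norm (f (z + v) - f z - D v) / norm v) \<le> K * norm v) (at 0)"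
  proof eventually_elim
    case (elim v)
    then show ?case using le[of v]
      by (cases "v = 0") (auto simp: divide_le_eq power2_eq_square mult_ac)
  qed
  from Lim_null_comparison[OF this lim]
  show "(\<lambda>v. norm (f (z + v) - f z - D v) / norm v) \<midarrow>0\<rightarrow> 0" .
qed

section \<open>Holomorphy of the frame form along exponentials\<close>

context bounded_bessel_family
begin

lemma AE_bounded_imp_sq_integrable:
  assumes "f \<in> borel_measurable borel" "\<And>x. norm x \<le> r \<Longrightarrow> cmod (f x) \<le> C"
  shows "sq_integrable M f"
proof (rule sq_integrable_AE_bounded)
  show "f \<in> borel_measurable M" using assms by (simp add: measurable_M_iff)
  show "AE x in M. cmod (f x) \<le> C" using bounded_support by eventually_elim (rule assms)
qed

lemma sqrt_L2_sqnorm_le: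
  assumes "f \<in> borel_measurable borel" "\<And>x. norm x \<le> r \<Longrightarrow> cmod (f x) \<le> C" "C \<ge> 0"
  shows "sqrt (L2_sqnorm M f) \<le> C"
proof -
  have "L2_sqnorm M f \<le> C\<^sup>2"
  proof (rule L2_sqnorm_le_bound[OF _ _ M_space])
    show "AE x in M. cmod (f x) \<le> C" using bounded_support by eventually_elim (rule assms)
    show "f \<in> borel_measurable M" using assms by (simp add: measurable_M_iff)
  qed
  then show ?thesis using assms(3) real_le_lsqrt by blast
qed

lemma sq_integrable_cexp: "sq_integrable M (cexp z)"
  by (rule AE_bounded_imp_sq_integrable) (auto intro: cmod_cexp_le)

lemma sq_integrable_cexp_deriv: "sq_integrable M (cexp_deriv z v)"
proof (rule AE_bounded_imp_sq_integrable)
  fix x :: "real^'n" assume x: "norm x \<le> r"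
  have "cmod (2 * pi * \<i> * cdot v x * cexp z x)
      \<le> (2 * pi * r * norm v) * exp (2 * pi * r * norm z)"
    unfolding norm_mult[of _ "cexp z x"]
    using r_nonneg by (intro mult_mono cmod_2_pi_i_cdot_le cmod_cexp_le x) auto
  then show "cmod (cexp_deriv z v x) \<le> (2 * pi * r * norm v) * exp (2 * pi * r * norm z)"
    by (simp add: cexp_deriv_def)
qed measurable

lemma sq_integrable_cexp_rem: "sq_integrable M (cexp_rem z v)"
proof -
  have "cexp_rem z v = (\<lambda>x. cexp (z + v) x - (cexp z x + cexp_deriv z v x))"
    by (simp add: cexp_expand fun_eq_iff)
  then show ?thesis
    by (simp add: sq_integrable_diff sq_integrable_add sq_integrable_cexp sq_integrable_cexp_deriv)
qed

text \<open>Both slots are expanded by \<open>cexp_expand\<close>. Bounded support turns the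
  pointwise bounds on the parts into L2 bounds, and boundedness of the form makes all products of
  order at least two quadratically small.\<close>

lemma entire_frame_form_cexp: "entire_fun (\<lambda>z. frame_form (cexp z) (cexp (vcnj z)))"
  unfolding entire_fun_def
proof
  fix z :: "complex^'n"
  \<comment> \<open>The first-order terms, one from each slot; complex linear because the two
    conjugations cancel.\<close>
  define D where "D v = frame_form (cexp_deriv z v) (cexp (vcnj z))
    + frame_form (cexp z) (cexp_deriv (vcnj z) (vcnj v))" for v
  have deriv_smult: "cexp_deriv w (c *s v) = (\<lambda>x. c * cexp_deriv w v x)" for w c and v :: "complex^'n"
    by (simp add: cexp_deriv_def fun_eq_iff cdot_smult)
  have deriv_add: "cexp_deriv w (u + v) = (\<lambda>x. cexp_deriv w u x + cexp_deriv w v x)"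
    for w u and v :: "complex^'n"
    by (simp add: cexp_deriv_def fun_eq_iff cdot_add algebra_simps)
  have D_smult: "D (c *s v) = c * D v" for c v
    by (simp add: D_def vcnj_smult deriv_smult frame_form_cmult_left frame_form_cmult_right algebra_simps)
  have D_add: "D (u + v) = D u + D v" for u v
    by (simp add: D_def vcnj_add deriv_add frame_form_add_left frame_form_add_right
        sq_integrable_cexp sq_integrable_cexp_deriv)
  have "linear D"
  proof (rule linearI)
    show "D (u + v) = D u + D v" for u v by (rule D_add)
    fix a and v :: "complex^'n"
    have "a *\<^sub>R v = complex_of_real a *s v"
      by (simp add: vec_eq_iff vector_scaleR_component scaleR_conv_of_real[where 'a = complex])
    then show "D (a *\<^sub>R v) = a *\<^sub>R D v"
      by (simp add: D_smult scaleR_conv_of_real)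
  qed
  then have bl: "bounded_linear D" by (simp add: linear_conv_bounded_linear)
  define C where "C = (1 + 2 * pi * r + (2 * pi * r)\<^sup>2 * exp (2 * pi * r)) * exp (2 * pi * r * norm z)"
  have C0: "C \<ge> 0" unfolding C_def using r_nonneg by (intro mult_nonneg_nonneg add_nonneg_nonneg) auto
  note sqi = sq_integrable_cexp sq_integrable_cexp_deriv sq_integrable_cexp_rem
  \<comment> \<open>Of the nine products in the expansion, the constant one cancels and two form D
    v. The other six are at most C^2 |v|^2 each, as |v| <= 1.\<close>
  have est: "cmod (frame_form (cexp (z + v)) (cexp (vcnj (z + v))) - frame_form (cexp z) (cexp (vcnj z)) - D v)
      \<le> 6 * C\<^sup>2 * (norm v)\<^sup>2" if v: "norm v \<le> 1" for v
  proof -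
    have v': "norm (vcnj v) \<le> 1" using v by (simp add: norm_vcnj)
    define n where "n = norm v"
    have n: "0 \<le> n" "n \<le> 1" using v by (auto simp: n_def)
    have n3: "n * n\<^sup>2 \<le> n\<^sup>2" "n\<^sup>2 * n\<^sup>2 \<le> n\<^sup>2"
      using n by (intro mult_left_le_one_le; simp add: power_le_one)+
    define E where "E = cexp z"
    define d where "d = cexp_deriv z v"
    define \<rho> where "\<rho> = cexp_rem z v"
    define E' where "E' = cexp (vcnj z)"
    define d' where "d' = cexp_deriv (vcnj z) (vcnj v)"
    define \<rho>' where "\<rho>' = cexp_rem (vcnj z) (vcnj v)"
    note defs = E_def d_def \<rho>_def E'_def d'_def \<rho>'_def
    have sq: "sq_integrable M E" "sq_integrable M d" "sq_integrable M \<rho>"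
      "sq_integrable M E'" "sq_integrable M d'" "sq_integrable M \<rho>'"
      by (simp_all add: defs sqi)
    have nrm: "sqrt (L2_sqnorm M E) \<le> C" "sqrt (L2_sqnorm M d) \<le> C * n" "sqrt (L2_sqnorm M \<rho>) \<le> C * n\<^sup>2"
      unfolding defs n_def
      by (rule sqrt_L2_sqnorm_le; use C0 cmod_cexp_bounds[OF _ v C_def] in simp)+
    have nrm': "sqrt (L2_sqnorm M E') \<le> C" "sqrt (L2_sqnorm M d') \<le> C * n" "sqrt (L2_sqnorm M \<rho>') \<le> C * n\<^sup>2"
      unfolding defs n_def norm_vcnj[of v, symmetric]
      by (rule sqrt_L2_sqnorm_le;
          use C0 cmod_cexp_bounds[OF _ v' C_def[folded norm_vcnj[of z]]] in simp)+
    have ff: "cmod (frame_form f g) \<le> a * b" if "sq_integrable M f" "sq_integrable M g"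
      "sqrt (L2_sqnorm M f) \<le> a" "sqrt (L2_sqnorm M g) \<le> b" for f g a b
    proof (rule order_trans[OF frame_form_bounds(2)[OF that(1,2)] mult_mono])
      show "0 \<le> a" using that(3) L2_sqnorm_nonneg real_sqrt_ge_zero order_trans by blast
    qed (use that L2_sqnorm_nonneg in auto)
    have "cexp (z + v) = (\<lambda>x. (E x + d x) + \<rho> x)" "cexp (vcnj (z + v)) = (\<lambda>x. (E' x + d' x) + \<rho>' x)"
      unfolding vcnj_add cexp_expand defs by auto
    then have expand: "frame_form (cexp (z + v)) (cexp (vcnj (z + v))) - frame_form (cexp z) (cexp (vcnj z)) - D v
      = frame_form E \<rho>' + frame_form d d' + frame_form d \<rho>' + frame_form \<rho> E' + frame_form \<rho> d' + frame_form \<rho> \<rho>'"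
      by (simp add: D_def defs[symmetric] frame_form_add_left frame_form_add_right sq sq_integrable_add)
    have "cmod (frame_form (cexp (z + v)) (cexp (vcnj (z + v))) - frame_form (cexp z) (cexp (vcnj z)) - D v)
        \<le> cmod (frame_form E \<rho>') + cmod (frame_form d d') + cmod (frame_form d \<rho>')
        + cmod (frame_form \<rho> E') + cmod (frame_form \<rho> d') + cmod (frame_form \<rho> \<rho>')"
      unfolding expand by (intro order_trans[OF norm_triangle_ineq] add_mono order_refl)
    also have "\<dots> \<le> C * (C * n\<^sup>2) + (C * n) * (C * n) + (C * n) * (C * n\<^sup>2)
        + (C * n\<^sup>2) * C + (C * n\<^sup>2) * (C * n) + (C * n\<^sup>2) * (C * n\<^sup>2)"
      using ff[OF sq(1,6) nrm(1) nrm'(3)] ff[OF sq(2,5) nrm(2) nrm'(2)] ff[OF sq(2,6) nrm(2) nrm'(3)]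
        ff[OF sq(3,4) nrm(3) nrm'(1)] ff[OF sq(3,5) nrm(3) nrm'(2)] ff[OF sq(3,6) nrm(3) nrm'(3)]
      by linarith
    also have "\<dots> = C\<^sup>2 * (3 * n\<^sup>2 + 2 * (n * n\<^sup>2) + n\<^sup>2 * n\<^sup>2)"
      by (simp add: power2_eq_square algebra_simps)
    also have "\<dots> \<le> C\<^sup>2 * (6 * n\<^sup>2)"
      using n3 by (intro mult_left_mono) auto
    finally show ?thesis by (simp add: n_def)
  qed
  show "\<exists>D. ((\<lambda>z. frame_form (cexp z) (cexp (vcnj z))) has_derivative D) (at z) \<and>
      (\<forall>c v. D (c *s v) = c * D v)"
    by (rule exI[of _ D]) (use has_derivative_quadratic_remainder[OF bl est] D_smult in auto)
qed

end

theorem theorem1p3: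
  fixes R :: "real^'n^'n" and B L :: "(real^'n) set" and \<mu> :: "(real^'n) measure"
    and \<alpha> :: "real^'n \<Rightarrow> complex"
  assumes "int_matrix R" and "expansive R"
    and "finite B" and "\<forall>b\<in>B. int_vec b" and "0 \<in> B"
    and "self_affine_measure R B \<mu>" and "no_overlap R B \<mu>"
    and "finite L" and "\<forall>l\<in>L. int_vec l" and "0 \<in> L"
    and "\<alpha> 0 = 1"
    and "\<forall>b\<in>B. \<forall>b'\<in>B.
           (\<Sum>l\<in>L. cnj (e_exp (matrix_inv (transpose R) *v l) b * \<alpha> l / sqrt (real (card B)))
                 * (e_exp (matrix_inv (transpose R) *v l) b' * \<alpha> l / sqrt (real (card B))))
           = (if b = b' then 1 else 0)"
    and "\<forall>h. entire_fun h \<and>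
           (\<forall>x. Im (h (cvec x)) = 0 \<and> 0 \<le> Re (h (cvec x)) \<and> Re (h (cvec x)) \<le> 1) \<and>
           h 0 = 1 \<and>
           (\<forall>t. (\<Sum>l\<in>L. complex_of_real ((cmod (\<alpha> l))\<^sup>2 *
                   (cmod (m_B B (matrix_inv (transpose R) *v (t - l))))\<^sup>2)
                   * h (cvec (matrix_inv (transpose R) *v (t - l)))) = h (cvec t))
         \<longrightarrow> h = (\<lambda>_. 1)"
  shows "parseval_frame_L2 \<mu> (Omega L)
           (\<lambda>ls x. word_coeff \<alpha> ls * e_exp (word_freq R ls) x)"
proof -
  interpret weighted_fourier R B \<mu> L \<alpha>
    using assms(1-12) by unfold_locales auto
  obtain r where r: "r \<ge> 0" "AE x in \<mu>. norm x \<le> r"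
    using self_affine_measure_bounded_support[OF expansive finite_B B_nonempty invariant] .
  interpret bounded_bessel_family \<mu> "Omega L" wexp r
    using r sets_mu measure_space_mu by unfold_locales auto
  \<comment> \<open>On real points \<open>vcnj\<close> is the identity, so this is an entire
    extension of t |-> energy (e_t).\<close>
  define h where "h z = frame_form (cexp z) (cexp (vcnj z))" for z
  have h_cvec: "h (cvec t) = complex_of_real (energy (e_exp t))" for t
    by (simp add: h_def vcnj_cvec cexp_cvec frame_form_self sq_integrable_e_exp)
  have cvec_0: "cvec 0 = 0" by (simp add: cvec_def vec_eq_iff)
  have "h = (\<lambda>_. 1)"
  proof (rule assms(13)[rule_format], intro conjI allI)
    show "entire_fun h" unfolding h_def by (rule entire_frame_form_cexp)
    show "h 0 = 1" using h_cvec[of 0] by (simp add: cvec_0 energy_e_exp_0)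
    show "Im (h (cvec x)) = 0" "0 \<le> Re (h (cvec x))" "Re (h (cvec x)) \<le> 1" for x
      by (simp_all add: h_cvec energy_nonneg energy_e_exp_le)
    show "(\<Sum>l\<in>L. complex_of_real ((cmod (\<alpha> l))\<^sup>2 *
        (cmod (m_B B (matrix_inv (transpose R) *v (t - l))))\<^sup>2)
        * h (cvec (matrix_inv (transpose R) *v (t - l)))) = h (cvec t)" for t
      unfolding h_cvec energy_e_exp_refine[of t] of_real_sum of_real_mult ..
  qed
  then have "energy (e_exp t) = 1" for t
    using h_cvec[of t] by (simp add: fun_eq_iff)
  \<comment> \<open>Exponentials have squared norm 1, so energy 1 means defect 0.\<close>
  then interpret exponentials_tight \<mu> "Omega L" wexp r
    by unfold_locales (simp add: tight_def defect_def sq_integrable_e_exp L2_sqnorm_e_exp)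
  show ?thesis
    unfolding parseval_frame_L2_def
  proof (intro allI impI)
    fix f :: "real^'n \<Rightarrow> complex"
    assume "f \<in> borel_measurable \<mu> \<and> integrable \<mu> (\<lambda>x. (cmod (f x))\<^sup>2)"
    then have f: "sq_integrable \<mu> f" by (simp add: sq_integrable_def)
    show "((\<lambda>w. (cmod (LINT x|\<mu>. f x * cnj (word_coeff \<alpha> w * e_exp (word_freq R w) x)))\<^sup>2) has_sum
        (LINT x|\<mu>. (cmod (f x))\<^sup>2)) (Omega L)"
      using has_sum_infsum[OF summable_energy[OF f]] energy_eq_L2_sqnorm[OF f]
      unfolding energy_def by (simp add: L2_inner_def L2_sqnorm_def wexp_def)
  qed
qed

end
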